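(* Let $\beta>1$ and let $\Pi$, $T$ be as in the context. (i) If $\beta<2$, then almost surely there exists an infinite geodesic path $(\varnothing=x_0,x_1,\ldots)$ in $\mathbb{T}$ with $\sum_{n\geq1}T(x_{n-1},x_n)<\infty$. (ii) If $\beta>2$, then almost surely every infinite geodesic path $(\varnothing=x_0,x_1,\ldots)$ in $\mathbb{T}$ satisfies $\sum_{n\geq1}T(x_{n-1},x_n)=\infty$.
   Context: $\mathbb{T}$ is the $3$-regular tree with graph distance $d$ and root $\varnothing$. A line is the vertex set $\{x_n:n\in\mathbb{Z}\}$ of a bi-infinite geodesic path. $\mathbb{L}$ is the set of lines, with the Borel structure generated by the sets $\langle x,y\rangle$ of lines passing through both $x$ and $y$ ($x\neq y$ vertices). $\mu$ is the unique Borel measure on $\mathbb{L}$ invariant under graph automorphisms with $\mu\langle x,y\rangle=2^{-d(x,y)}$ for all $x\neq y$. $\Pi$ is a Poisson process on $\mathbb{L}\times(0,\infty)$ with intensity $\nu=(\beta-1)\,\mu\otimes v^{-\beta}\,\mathrm{d}v$. Each atom $(\ell,v)$ is called a road with line $\ell$ and speed $v$. For an edge $e$ of $\mathbb{T}$, $V_e$ is the largest speed of a road of $\Pi$ whose line contains both endpoints of $e$. For vertices $x,y$, $T(x,y)=\sum_{i=1}^n V_{e_i}^{-1}$, where $e_1,\dots,e_n$ are the edges of the geodesic from $x$ to $y$ (this is the driving distance). *)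

theory Defs
  imports "HOL-Probability.Probability"
begin

text \<open>Vertices: finite words over {0,1,2} without two equal consecutive letters.
  The root is the empty word; x and y are adjacent iff one extends the other by one
  letter. The root has 3 neighbours, every other vertex has 1 parent and 2 children,
  so this is the 3-regular tree.\<close>

typedef tvert = "{w :: nat list. set w \<subseteq> {0..<3} \<and>
                     (\<forall>i. Suc i < length w \<longrightarrow> w ! i \<noteq> w ! Suc i)}"
  by (rule exI[of _ "[]"]) simp

definition troot :: tvert where
  "troot = Abs_tvert []"

definition tadj :: "tvert \<Rightarrow> tvert \<Rightarrow> bool" where
  "tadj x y \<longleftrightarrow> (\<exists>a. Rep_tvert y = Rep_tvert x @ [a]) \<or> (\<exists>a. Rep_tvert x = Rep_tvert y @ [a])"

definition tadj_rel :: "(tvert \<times> tvert) set" where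
  "tadj_rel = {(x, y). tadj x y}"

definition tdist :: "tvert \<Rightarrow> tvert \<Rightarrow> nat" where
  "tdist x y = (LEAST n. (x, y) \<in> tadj_rel ^^ n)"

definition tree_automorphism :: "(tvert \<Rightarrow> tvert) \<Rightarrow> bool" where
  "tree_automorphism \<phi> \<longleftrightarrow> bij \<phi> \<and> (\<forall>x y. tadj x y \<longleftrightarrow> tadj (\<phi> x) (\<phi> y))"

definition inf_geodesic_from :: "tvert \<Rightarrow> (nat \<Rightarrow> tvert) \<Rightarrow> bool" where
  "inf_geodesic_from x0 x \<longleftrightarrow> x 0 = x0 \<and>
     (\<forall>m n. tdist (x m) (x n) = (if m \<le> n then n - m else m - n))"

definition tlines :: "tvert set set" where
  "tlines = {L. \<exists>f :: int \<Rightarrow> tvert. (\<forall>m n. tdist (f m) (f n) = nat \<bar>m - n\<bar>) \<and> L = range f}"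

definition line_through :: "tvert \<Rightarrow> tvert \<Rightarrow> tvert set set" where
  "line_through x y = {L \<in> tlines. x \<in> L \<and> y \<in> L}"

definition line_generators :: "tvert set set set" where
  "line_generators = {line_through x y | x y. x \<noteq> y}"

text \<open>mu is a measure on the lines with the Borel structure generated by the sets
  line_through x y, invariant under tree automorphisms, with
  mu (line_through x y) = 2^(-d(x,y)) for x \<noteq> y. (Such a measure is unique.)\<close>
definition line_measure :: "tvert set measure \<Rightarrow> bool" where
  "line_measure \<mu> \<longleftrightarrow>
     space \<mu> = tlines \<and>
     sets \<mu> = sigma_sets tlines line_generators \<and>
     (\<forall>x y. x \<noteq> y \<longrightarrow> emeasure \<mu> (line_through x y) = ennreal ((1/2) ^ tdist x y)) \<and>
     (\<forall>\<phi>. tree_automorphism \<phi> \<longrightarrow>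
        (\<forall>S \<in> sets \<mu>. emeasure \<mu> ((\<lambda>L. \<phi> ` L) -` S \<inter> space \<mu>) = emeasure \<mu> S))"

definition road_intensity :: "tvert set measure \<Rightarrow> real \<Rightarrow> (tvert set \<times> real) measure" where
  "road_intensity \<mu> \<beta> = \<mu> \<Otimes>\<^sub>M
     density (restrict_space lborel {0<..}) (\<lambda>v. ennreal ((\<beta> - 1) * v powr (- \<beta>)))"

definition pcount :: "'a set \<Rightarrow> 'a set \<Rightarrow> ennreal" where
  "pcount S A = emeasure (count_space UNIV) (S \<inter> A)"

definition poisson_process :: "'w measure \<Rightarrow> 'a measure \<Rightarrow> ('w \<Rightarrow> 'a set) \<Rightarrow> bool" where
  "poisson_process P \<nu> Roads \<longleftrightarrow>
     prob_space P \<and>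
     (\<forall>\<omega> \<in> space P. Roads \<omega> \<subseteq> space \<nu>) \<and>
     (\<forall>A \<in> sets \<nu>. (\<lambda>\<omega>. pcount (Roads \<omega>) A) \<in> borel_measurable P) \<and>
     (\<forall>A \<in> sets \<nu>. emeasure \<nu> A < \<infinity> \<longrightarrow>
        (\<forall>k :: nat. measure P {\<omega> \<in> space P. pcount (Roads \<omega>) A = of_nat k}
            = (enn2real (emeasure \<nu> A)) ^ k / fact k * exp (- enn2real (emeasure \<nu> A)))) \<and>
     (\<forall>A \<in> sets \<nu>. emeasure \<nu> A = \<infinity> \<longrightarrow> (AE \<omega> in P. pcount (Roads \<omega>) A = \<infinity>)) \<and>
     (\<forall>(I :: nat set) A. finite I \<longrightarrow> (\<forall>i \<in> I. A i \<in> sets \<nu>) \<longrightarrow> disjoint_family_on A I \<longrightarrow>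
        prob_space.indep_vars P (\<lambda>_. borel) (\<lambda>i \<omega>. pcount (Roads \<omega>) (A i)) I)"

definition edge_speed :: "(tvert set \<times> real) set \<Rightarrow> tvert \<Rightarrow> tvert \<Rightarrow> real" where
  "edge_speed R x y = Sup {v. \<exists>L. (L, v) \<in> R \<and> x \<in> L \<and> y \<in> L}"

definition geodesic_vertices :: "tvert \<Rightarrow> tvert \<Rightarrow> tvert set" where
  "geodesic_vertices x y = {z. tdist x z + tdist z y = tdist x y}"

definition geodesic_edges :: "tvert \<Rightarrow> tvert \<Rightarrow> (tvert \<times> tvert) set" where
  "geodesic_edges x y = {(u, v). tadj u v \<and> u \<in> geodesic_vertices x y \<and> v \<in> geodesic_vertices x y
                                  \<and> tdist x v = Suc (tdist x u)}"

definition driving_distance :: "(tvert set \<times> real) set \<Rightarrow> tvert \<Rightarrow> tvert \<Rightarrow> real" where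
  "driving_distance R x y = (\<Sum>(u, v) \<in> geodesic_edges x y. 1 / edge_speed R u v)"

end

theory Submission
  imports Defs
begin

text \<open>
  Void events \<open>Roads \<inter> A = {}\<close> are closed under intersection, so independence of the Poisson process
  on disjoint sets extends from counts to the sigma-algebras generated by void events. Speeds are
  grouped into the dyadic slabs \<open>(2^k, 2^(k+1)]\<close>.

  For \<open>\<beta> < 2\<close>, ride a road of slab \<open>n\<close> until a road of slab \<open>n + 1\<close> branches off. At each
  vertex this has probability of order \<open>2^(-n(\<beta>-1))\<close>, independently of the past, so
  \<open>O(n 2^(n(\<beta>-1)))\<close> edges suffice except with probability \<open>e^(-n)\<close>. These edges cost
  \<open>O(n 2^(-n(2-\<beta>)))\<close>, which is summable. Starting at a late stage makes the failure probability small.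

  For \<open>\<beta> > 2\<close>, the Laplace transform \<open>\<Sum>\<^sub>w exp (-\<theta> T(\<emptyset>, w))\<close> has finite expectation
  for large \<open>\<theta>\<close>, so \<open>T\<close> tends to infinity along every ray. The Lyapunov function is
  \<open>1 + \<Sum> \<phi>(v)\<close>, summed over the roads through the edge above \<open>w\<close> with speed \<open>v \<ge> 2^k0\<close>, where
  \<open>\<phi>(v)\<close> is of order \<open>v\<close>. Every road entering \<open>w\<close> from above continues to exactly one child, so the
  sum over the children only gains the roads turning at \<open>w\<close>. These are independent of the past
  and contribute a small amount because \<open>\<integral> v \<cdot> v^(-\<beta>) dv\<close> converges at infinity. The factor
  \<open>exp (-\<theta> / V)\<close> applied to the term of the fastest road outweighs this gain and the factor 2
  from branching.
\<close>

section \<open>Lines in the 3-regular tree\<close>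

definition tword :: "nat list \<Rightarrow> bool" where
  "tword w \<longleftrightarrow> set w \<subseteq> {0..<3} \<and> (\<forall>i. Suc i < length w \<longrightarrow> w ! i \<noteq> w ! Suc i)"

abbreviation tlen :: "tvert \<Rightarrow> nat" where
  "tlen x \<equiv> length (Rep_tvert x)"

lemma tword_Rep [simp]: "tword (Rep_tvert x)"
  using Rep_tvert[of x] by (simp add: tword_def)

lemma Rep_Abs_tvert [simp]: "tword w \<Longrightarrow> Rep_tvert (Abs_tvert w) = w"
  by (rule Abs_tvert_inverse) (simp add: tword_def)

lemma Abs_tvert_eq_iff: "tword u \<Longrightarrow> tword w \<Longrightarrow> Abs_tvert u = Abs_tvert w \<longleftrightarrow> u = w"
  by (metis Rep_Abs_tvert)

lemma tword_Nil [simp]: "tword []"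
  by (simp add: tword_def)

lemma Rep_troot [simp]: "Rep_tvert troot = []"
  by (simp add: troot_def)

lemma tword_snoc: "tword (w @ [a]) \<longleftrightarrow> tword w \<and> a < 3 \<and> (w \<noteq> [] \<longrightarrow> a \<noteq> last w)"
proof (cases w rule: rev_cases)
  case (snoc u b)
  show ?thesis
  proof
    assume t: "tword (w @ [a])"
    have "w ! i \<noteq> w ! Suc i" if "Suc i < length w" for i
      using t that unfolding tword_def by (metis Suc_lessD length_append_singleton less_Suc_eq nth_append)
    moreover have "a \<noteq> b"
      using t[unfolded tword_def, THEN conjunct2, rule_format, of "length u"]
      by (simp add: snoc nth_append)
    ultimately show "tword w \<and> a < 3 \<and> (w \<noteq> [] \<longrightarrow> a \<noteq> last w)"
      using t by (auto simp: tword_def snoc)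
  next
    assume r: "tword w \<and> a < 3 \<and> (w \<noteq> [] \<longrightarrow> a \<noteq> last w)"
    show "tword (w @ [a])"
      unfolding tword_def
    proof (intro conjI allI impI)
      show "set (w @ [a]) \<subseteq> {0..<3}"
        using r by (auto simp: tword_def)
      fix i assume i: "Suc i < length (w @ [a])"
      show "(w @ [a]) ! i \<noteq> (w @ [a]) ! Suc i"
      proof (cases "Suc i < length w")
        case True
        then show ?thesis using r by (simp add: tword_def nth_append)
      next
        case False
        then have "i = length u" using i by (simp add: snoc)
        then show ?thesis using r by (simp add: snoc nth_append)
      qed
    qed
  qed
qed (auto simp: tword_def)

lemma tword_appendD: "tword (u @ w) \<Longrightarrow> tword u"
  by (induction w rule: rev_induct) (auto simp: tword_snoc simp flip: append_assoc)

lemma tword_take: "tword w \<Longrightarrow> tword (take k w)"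
  by (metis append_take_drop_id tword_appendD)

lemma tword_butlast: "tword w \<Longrightarrow> tword (butlast w)"
  by (simp add: butlast_conv_take tword_take)

section \<open>Adjacency and graph distance in terms of words\<close>

lemma tadj_sym: "tadj x y \<Longrightarrow> tadj y x"
  by (auto simp: tadj_def)

lemma tadj_snoc:
  assumes "tword (w @ [a])"
  shows "tadj (Abs_tvert w) (Abs_tvert (w @ [a]))"
  using assms tword_appendD[OF assms] by (auto simp: tadj_def)

lemma tadj_irrefl: "\<not> tadj x x"
  by (auto simp: tadj_def)

lemma tadj_rel_relpow_sym: "(x, y) \<in> tadj_rel ^^ n \<Longrightarrow> (y, x) \<in> tadj_rel ^^ n"
proof (induction n arbitrary: x y)
  case (Suc n)
  then obtain z where "(x, z) \<in> tadj_rel ^^ n" "(z, y) \<in> tadj_rel"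
    by auto
  then have "(y, z) \<in> tadj_rel" "(z, x) \<in> tadj_rel ^^ n"
    using Suc.IH[of x z] tadj_sym[of z y] by (auto simp: tadj_rel_def)
  then show ?case by (rule relpow_Suc_I2)
qed auto

lemma relpow_append_word:
  "tword (u @ w) \<Longrightarrow> (Abs_tvert u, Abs_tvert (u @ w)) \<in> tadj_rel ^^ length w"
proof (induction w rule: rev_induct)
  case (snoc a w)
  then show ?case
    using tadj_snoc[of "u @ w" a] tword_appendD[of "u @ w" "[a]"]
    by (auto simp: tadj_rel_def intro!: relpow_Suc_I)
qed auto

text \<open>Every vertex is joined to the root through its prefixes, so the \<open>LEAST\<close> in
  \<open>tdist\<close> is attained.\<close>

lemma tree_connected: "\<exists>n. (x, y) \<in> tadj_rel ^^ n"
proof -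
  have *: "(troot, z) \<in> tadj_rel ^^ tlen z" for z
    using relpow_append_word[of "[]" "Rep_tvert z"]
    by (simp add: troot_def Rep_tvert_inverse)
  then have "(x, y) \<in> tadj_rel ^^ (tlen x + tlen y)"
    using tadj_rel_relpow_sym[OF *[of x]] by (auto simp: relpow_add)
  then show ?thesis ..
qed

lemma tdist_relpow: "(x, y) \<in> tadj_rel ^^ tdist x y"
  unfolding tdist_def using tree_connected by (rule LeastI_ex)

lemma tdist_le: "(x, y) \<in> tadj_rel ^^ n \<Longrightarrow> tdist x y \<le> n"
  unfolding tdist_def by (rule Least_le)

lemma tdist_sym: "tdist x y = tdist y x"
  by (meson tdist_le tdist_relpow tadj_rel_relpow_sym le_antisym)

lemma tdist_self [simp]: "tdist x x = 0"
  using tdist_le[of x x 0] by simp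

lemma tdist_eq_0_iff [simp]: "tdist x y = 0 \<longleftrightarrow> x = y"
  using tdist_relpow[of x y] by auto

lemma tdist_eq_1_iff: "tdist x y = Suc 0 \<longleftrightarrow> tadj x y"
proof
  assume "tdist x y = Suc 0"
  then show "tadj x y" using tdist_relpow[of x y] by (auto simp: tadj_rel_def)
next
  assume a: "tadj x y"
  then have "tdist x y \<le> Suc 0" by (intro tdist_le) (auto simp: tadj_rel_def)
  moreover have "tdist x y \<noteq> 0" using a tadj_irrefl by auto
  ultimately show "tdist x y = Suc 0" by linarith
qed

text \<open>Each step lengthens a word by at most one letter, so differences of length bound
  distances from below. This is the lower bound in \<open>tdist_append\<close>.\<close>

lemma tlen_relpow: "(x, y) \<in> tadj_rel ^^ n \<Longrightarrow> tlen y \<le> tlen x + n"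
proof (induction n arbitrary: y)
  case (Suc n)
  then obtain z where z: "(x, z) \<in> tadj_rel ^^ n" "tadj z y"
    by (auto simp: tadj_rel_def)
  then have "tlen y \<le> Suc (tlen z)" by (auto simp: tadj_def)
  then show ?case using Suc.IH[OF z(1)] by simp
qed auto

lemma tlen_le_tdist: "tlen y \<le> tlen x + tdist x y"
  using tlen_relpow[OF tdist_relpow] .

lemma tdist_append: 
  assumes "tword (u @ w)"
  shows "tdist (Abs_tvert u) (Abs_tvert (u @ w)) = length w"
proof (rule antisym)
  show "tdist (Abs_tvert u) (Abs_tvert (u @ w)) \<le> length w"
    using tdist_le[OF relpow_append_word[OF assms]] .
  show "length w \<le> tdist (Abs_tvert u) (Abs_tvert (u @ w))"
    using tlen_le_tdist[of "Abs_tvert (u @ w)" "Abs_tvert u"] assms tword_appendD[OF assms] by simp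
qed

lemma tdist_troot: "tdist troot x = tlen x"
  using tdist_append[of "[]" "Rep_tvert x"] by (simp add: troot_def Rep_tvert_inverse)

text \<open>Adjacent words differ in length, so siblings are not adjacent and the path through their
  parent is shortest.\<close>

lemma tdist_siblings:
  assumes "tword (w @ [a])" "tword (w @ [b])" "a \<noteq> b"
  shows "tdist (Abs_tvert (w @ [a])) (Abs_tvert (w @ [b])) = 2"
proof -
  let ?x = "Abs_tvert (w @ [a])" and ?y = "Abs_tvert (w @ [b])"
  have "(?x, ?y) \<in> tadj_rel ^^ Suc (Suc 0)"
    using tadj_snoc[OF assms(1)] tadj_snoc[OF assms(2)] tadj_sym
    by (intro relpow_Suc_I[of _ "Abs_tvert w"] relpow_Suc_I[of _ "?x"]) (auto simp: tadj_rel_def)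
  from tdist_le[OF this] have "tdist ?x ?y \<le> 2" by simp
  moreover have "?x \<noteq> ?y" using assms by (simp add: Abs_tvert_eq_iff)
  moreover have "\<not> tadj ?x ?y" using assms by (auto simp: tadj_def)
  ultimately show ?thesis using tdist_eq_0_iff[of ?x ?y] tdist_eq_1_iff[of ?x ?y] by linarith
qed

lemma inf_geodesicI:
  assumes w: "\<And>n. tword (w n)" and "\<And>n. length (w n) = n" and "\<And>n. butlast (w (Suc n)) = w n"
  shows "inf_geodesic_from troot (\<lambda>n. Abs_tvert (w n))"
proof -
  have pre: "\<exists>v. w (m + k) = w m @ v \<and> length v = k" for m k
  proof (induction k)
    case (Suc k)
    then obtain v where v: "w (m + k) = w m @ v" "length v = k" by auto
    have "w (Suc (m + k)) = w (m + k) @ [last (w (Suc (m + k)))]"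
      using assms(2,3)[of "Suc (m + k)"] assms(3)[of "m + k"]
      by (metis append_butlast_last_id list.size(3) nat.distinct(1))
    then show ?case using v by auto
  qed auto
  have d: "tdist (Abs_tvert (w m)) (Abs_tvert (w n)) = n - m" if mn: "m \<le> n" for m n
  proof -
    obtain v where "w n = w m @ v" "length v = n - m" using pre[of m "n - m"] mn by auto
    then show ?thesis using tdist_append[of "w m" v] w[of n] by simp
  qed
  show ?thesis
    unfolding inf_geodesic_from_def
  proof (intro conjI allI)
    show "Abs_tvert (w 0) = troot" using assms(2)[of 0] by (simp add: troot_def)
    fix m n show "tdist (Abs_tvert (w m)) (Abs_tvert (w n)) = (if m \<le> n then n - m else m - n)"
      using d[of m n] d[of n m] tdist_sym by auto
  qed
qed

lemma inf_geodesic_tlen: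
  assumes "inf_geodesic_from troot x"
  shows "tlen (x n) = n"
proof -
  have "tdist (x 0) (x n) = (if 0 \<le> n then n - 0 else 0 - n)" "x 0 = troot"
    using assms unfolding inf_geodesic_from_def by blast+
  then show ?thesis by (simp add: tdist_troot)
qed

lemma inf_geodesic_tadj:
  assumes "inf_geodesic_from troot x"
  shows "tadj (x n) (x (Suc n))"
  using assms by (simp add: inf_geodesic_from_def flip: tdist_eq_1_iff)

lemma inf_geodesic_Suc:
  assumes "inf_geodesic_from troot x"
  shows "\<exists>a. Rep_tvert (x (Suc n)) = Rep_tvert (x n) @ [a]"
  using inf_geodesic_tadj[OF assms, of n] inf_geodesic_tlen[OF assms, of n]
    inf_geodesic_tlen[OF assms, of "Suc n"]
  by (auto simp: tadj_def)

text \<open>\<open>geodesic_edges\<close> orients edges away from \<open>x\<close>, so an edge is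
  listed once and the driving distance of neighbours is the reciprocal of a single edge
  speed.\<close>

lemma geodesic_edges_tadj:
  assumes "tadj x y"
  shows "geodesic_edges x y = {(x, y)}"
proof -
  have d: "tdist x y = 1" using assms by (simp add: tdist_eq_1_iff)
  have "geodesic_vertices x y = {x, y}"
  proof -
    have "z = x \<or> z = y" if "tdist x z + tdist z y = 1" for z
    proof (cases "tdist x z")
      case (Suc n)
      then have "tdist z y = 0" using that by simp
      then show ?thesis by simp
    qed simp
    then show ?thesis using d by (auto simp: geodesic_vertices_def)
  qed
  then show ?thesis using assms d
    by (auto simp: geodesic_edges_def tadj_irrefl tdist_sym)
qed

lemma driving_distance_tadj: "tadj x y \<Longrightarrow> driving_distance R x y = 1 / edge_speed R x y"
  by (simp add: driving_distance_def geodesic_edges_tadj)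

section \<open>How a line passes through a vertex, its parent and its children\<close>

lemma tline_obtain:
  assumes "L \<in> tlines" "z \<in> L"
  obtains f :: "int \<Rightarrow> tvert" where "\<And>m n. tdist (f m) (f n) = nat \<bar>m - n\<bar>" "L = range f" "f 0 = z"
proof -
  obtain g :: "int \<Rightarrow> tvert" where g: "\<And>m n. tdist (g m) (g n) = nat \<bar>m - n\<bar>" "L = range g"
    using assms(1) by (auto simp: tlines_def)
  obtain k where k: "z = g k" using assms(2) g(2) by auto
  have "g i \<in> range (\<lambda>i. g (i + k))" for i
    by (rule range_eqI[of _ _ "i - k"]) simp
  then have "range (\<lambda>i. g (i + k)) = range g" by auto
  then show ?thesis using that[of "\<lambda>i. g (i + k)"] g k by simp
qed

lemma tline_neighbours:
  assumes "L \<in> tlines" "z \<in> L"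
  obtains a b where "a \<noteq> b" "{w \<in> L. tadj z w} = {a, b}"
proof -
  obtain f :: "int \<Rightarrow> tvert" where f: "\<And>m n. tdist (f m) (f n) = nat \<bar>m - n\<bar>" "L = range f" "f 0 = z"
    using tline_obtain[OF assms] by blast
  have "tadj z (f k) \<longleftrightarrow> k = 1 \<or> k = -1" for k
    using f(1)[of 0 k] f(3) by (auto simp flip: tdist_eq_1_iff)
  then have "{w \<in> L. tadj z w} = {f 1, f (-1)}" using f(2) by auto
  moreover have "f 1 \<noteq> f (-1)" using f(1)[of 1 "-1"] tdist_self by force
  ultimately show ?thesis using that by blast
qed

lemma tline_two_neighbours:
  assumes "L \<in> tlines" "z \<in> L" "tadj z a" "a \<in> L"
  shows "\<exists>b. b \<noteq> a \<and> {w \<in> L. tadj z w} = {a, b}"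
proof -
  obtain c d where cd: "c \<noteq> d" "{w \<in> L. tadj z w} = {c, d}"
    using tline_neighbours[OF assms(1,2)] by metis
  then have "a = c \<or> a = d" using assms by blast
  then show ?thesis using cd by (metis insert_commute)
qed

definition other_letters :: "nat list \<Rightarrow> nat set" where
  "other_letters w = {a. a < 3 \<and> (w \<noteq> [] \<longrightarrow> a \<noteq> last w)}"

lemma tword_snoc_iff: "tword (w @ [a]) \<longleftrightarrow> tword w \<and> a \<in> other_letters w"
  by (simp add: tword_snoc other_letters_def)

lemma tadj_Abs_iff:
  assumes "tword w" "w \<noteq> []"
  shows "tadj (Abs_tvert w) y \<longleftrightarrow> y = Abs_tvert (butlast w) \<or> (\<exists>a\<in>other_letters w. y = Abs_tvert (w @ [a]))"
proof -
  have 1: "Rep_tvert y = w @ [a] \<longleftrightarrow> a \<in> other_letters w \<and> y = Abs_tvert (w @ [a])" for a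
    using assms by (metis Rep_Abs_tvert Rep_tvert_inverse tword_Rep tword_snoc_iff)
  have 2: "(\<exists>a. w = Rep_tvert y @ [a]) \<longleftrightarrow> y = Abs_tvert (butlast w)"
    using assms by (metis Rep_Abs_tvert Rep_tvert_inverse append_butlast_last_id butlast_snoc tword_butlast)
  show ?thesis using assms 1 2 by (auto simp: tadj_def)
qed

lemma tadj_parent: "tword w \<Longrightarrow> w \<noteq> [] \<Longrightarrow> tadj (Abs_tvert w) (Abs_tvert (butlast w))"
  by (simp add: tadj_Abs_iff)

lemma other_letters_nonempty_word:
  assumes "tword w" "w \<noteq> []" "a \<in> other_letters w"
  obtains b where "b \<noteq> a" "other_letters w = {a, b}"
proof -
  define l where "l = last w"
  have l: "l < 3" using assms by (metis append_butlast_last_id tword_snoc l_def)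
  have a: "a < 3" "a \<noteq> l" using assms by (auto simp: other_letters_def l_def)
  have la: "(l, a) \<in> {(0, 1), (0, 2), (1, 0), (1, 2), (2, 0), (2, 1)}"
    using l a by (simp add: numeral_3_eq_3 numeral_2_eq_2 less_Suc_eq) blast
  \<comment> \<open>The letters 0, 1, 2 add up to 3, so \<open>3 - l - a\<close> is the remaining
    one.\<close>
  have "x < 3 \<and> x \<noteq> l \<longleftrightarrow> x = a \<or> x = 3 - l - a" for x
    using la by auto
  then have "other_letters w = {a, 3 - l - a}"
    using assms(2) by (auto simp: other_letters_def l_def)
  moreover have "3 - l - a \<noteq> a" using la by auto
  ultimately show ?thesis using that by blast
qed

text \<open>The neighbour on \<open>L\<close> one step towards \<open>Abs_tvert u\<close> cannot be
  a child of \<open>u @ v\<close>, since children are farther from \<open>u\<close>; hence it is the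
  parent.\<close>

lemma line_through_parent_in:
  assumes L: "L \<in> tlines" and w: "tword (u @ v)" "v \<noteq> []"
    and "Abs_tvert u \<in> L" "Abs_tvert (u @ v) \<in> L"
  shows "Abs_tvert (u @ butlast v) \<in> L"
proof -
  obtain f :: "int \<Rightarrow> tvert" where f: "\<And>m n. tdist (f m) (f n) = nat \<bar>m - n\<bar>" "L = range f"
      "f 0 = Abs_tvert (u @ v)"
    using tline_obtain[OF L assms(5)] by blast
  obtain k where k: "f k = Abs_tvert u" using assms f(2) by auto
  have kl: "nat \<bar>k\<bar> = length v" using tdist_append[OF w(1)] f(1)[of k 0] f(3) k by simp
  \<comment> \<open>\<open>f s\<close> is the neighbour of \<open>f 0\<close> on the side of
    \<open>f k\<close>.\<close>
  define s :: int where "s = sgn k"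
  have s: "nat \<bar>s\<bar> = 1" "nat \<bar>k - s\<bar> < length v"
    using kl w(2) by (auto simp: s_def sgn_if nat_less_iff)
  have "tadj (Abs_tvert (u @ v)) (f s)"
    using f(1)[of 0 s] f(3) s by (simp flip: tdist_eq_1_iff)
  then have "f s = Abs_tvert (butlast (u @ v)) \<or> (\<exists>a\<in>other_letters (u @ v). f s = Abs_tvert ((u @ v) @ [a]))"
    using w by (subst (asm) tadj_Abs_iff) auto
  moreover have False if "a \<in> other_letters (u @ v)" "f s = Abs_tvert ((u @ v) @ [a])" for a
  proof -
    have "tword (u @ (v @ [a]))" using that w by (simp add: tword_snoc_iff flip: append_assoc)
    from tdist_append[OF this] have "nat \<bar>k - s\<bar> = length v + 1"
      using f(1)[of k s] k that by simp
    then show False using s by simp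
  qed
  ultimately have "f s = Abs_tvert (u @ butlast v)" using w by (auto simp: butlast_append)
  then show ?thesis using f(2) by (metis rangeI)
qed

lemma line_through_prefix_in:
  assumes L: "L \<in> tlines" and w: "tword (u @ v)"
    and "Abs_tvert u \<in> L" "Abs_tvert (u @ v) \<in> L"
  shows "Abs_tvert (u @ take k v) \<in> L"
  using w assms(4)
proof (induction v arbitrary: k rule: rev_induct)
  case Nil
  then show ?case by simp
next
  case (snoc a v)
  have v: "Abs_tvert (u @ v) \<in> L"
    using line_through_parent_in[OF L, of u "v @ [a]"] snoc.prems assms(3) by simp
  show ?case
  proof (cases "k \<le> length v")
    case True
    then show ?thesis using snoc.IH[OF _ v, of k] tword_appendD[of "u @ v" "[a]"] snoc.prems by simp
  next
    case False
    then show ?thesis using snoc.prems by simp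
  qed
qed

text \<open>The midpoint of the segment between the siblings is adjacent to both. If it were not
  \<open>w\<close>, it would extend both words by a letter, which is impossible for distinct words
  of equal length.\<close>

lemma line_through_siblings_apex:
  assumes L: "L \<in> tlines" and w: "tword (w @ [a])" "tword (w @ [b])" "a \<noteq> b"
    and in_L: "Abs_tvert (w @ [a]) \<in> L" "Abs_tvert (w @ [b]) \<in> L"
  shows "Abs_tvert w \<in> L"
proof -
  obtain f :: "int \<Rightarrow> tvert" where f: "\<And>m n. tdist (f m) (f n) = nat \<bar>m - n\<bar>" "L = range f"
      "f 0 = Abs_tvert (w @ [a])"
    using tline_obtain[OF L in_L(1)] by blast
  obtain k where k: "f k = Abs_tvert (w @ [b])" using in_L f(2) by auto
  have k2: "nat \<bar>k\<bar> = 2" using f(1)[of 0 k] f(3) k tdist_siblings[OF w] by simp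
  define s :: int where "s = sgn k"
  have s: "nat \<bar>s\<bar> = 1" "nat \<bar>k - s\<bar> = 1"
    using k2 by (auto simp: s_def sgn_if)
  have adj: "tadj (Abs_tvert (w @ [a])) (f s)" "tadj (Abs_tvert (w @ [b])) (f s)"
    using f(1)[of 0 s] f(1)[of k s] f(3) k s by (simp_all flip: tdist_eq_1_iff)
  have "tlen (f s) = length w" if "f s \<noteq> Abs_tvert w"
  proof -
    have "\<exists>c. Rep_tvert (f s) = (w @ [a]) @ [c]" "\<exists>c. Rep_tvert (f s) = (w @ [b]) @ [c]"
      using adj that w Rep_tvert_inverse[of "f s"] by (auto simp: tadj_def)
    then show ?thesis using w by auto
  qed
  moreover have "tlen (f s) \<noteq> length w" if "f s \<noteq> Abs_tvert w"
    using adj that w Rep_tvert_inverse[of "f s"] by (auto simp: tadj_def)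
  ultimately have "f s = Abs_tvert w" by auto
  then show ?thesis using f(2) by (metis rangeI)
qed

text \<open>A proper ancestor on the line would put the parent of \<open>w\<close> on it too, and
  \<open>w\<close> would then have three neighbours on one line. This separates the roads turning at
  \<open>w\<close> from those over the path to \<open>w\<close>, and the branch sets at different
  depths from each other.\<close>

lemma line_through_siblings_above:
  assumes L: "L \<in> tlines" and w: "tword (w @ [a])" "tword (w @ [b])" "a \<noteq> b"
    and in_L: "Abs_tvert (w @ [a]) \<in> L" "Abs_tvert (w @ [b]) \<in> L"
    and k: "k < length w"
  shows "Abs_tvert (take k w) \<notin> L"
proof
  assume "Abs_tvert (take k w) \<in> L"
  moreover have t: "tword w" using w by (simp add: tword_snoc)
  moreover have apex: "Abs_tvert w \<in> L" using line_through_siblings_apex[OF L w in_L] .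
  ultimately have "Abs_tvert (take k w @ butlast (drop k w)) \<in> L"
    using line_through_parent_in[OF L, of "take k w" "drop k w"] k by simp
  moreover have "take k w @ butlast (drop k w) = butlast w"
    using k by (metis append_take_drop_id butlast_append drop_eq_Nil not_le)
  ultimately have p: "Abs_tvert (butlast w) \<in> L" by simp
  have ne: "w \<noteq> []" using k by auto
  obtain c where "{z \<in> L. tadj (Abs_tvert w) z} = {Abs_tvert (butlast w), c}"
    using tline_two_neighbours[OF L apex tadj_parent[OF t ne] p] by auto
  moreover have "Abs_tvert (w @ [a]) \<in> {z \<in> L. tadj (Abs_tvert w) z}"
    "Abs_tvert (w @ [b]) \<in> {z \<in> L. tadj (Abs_tvert w) z}"
    using in_L tadj_snoc w by auto
  ultimately have "Abs_tvert (w @ [a]) = Abs_tvert (w @ [b]) \<or> Abs_tvert (w @ [a]) = Abs_tvert (butlast w)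
     \<or> Abs_tvert (w @ [b]) = Abs_tvert (butlast w)" by auto
  then show False
    using w t by (auto simp: Abs_tvert_eq_iff tword_butlast dest: arg_cong[of _ _ length])
qed

lemma line_through_commute: "line_through x y = line_through y x"
  by (auto simp: line_through_def)

text \<open>A line through \<open>w\<close> contains exactly two of its three neighbours. Hence
  lines arriving from the parent split according to the child they continue to, and lines over a
  child edge either come from the parent or turn between the two children.\<close>

lemma line_through_split:
  assumes t: "tword w" and ne: "w \<noteq> []" and o: "other_letters w = {a, b}" and ab: "a \<noteq> b"
  defines "p \<equiv> Abs_tvert (butlast w)" and "x \<equiv> Abs_tvert w"
    and "y \<equiv> Abs_tvert (w @ [a])" and "z \<equiv> Abs_tvert (w @ [b])"
  shows "line_through p x = line_through p y \<union> line_through p z"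
    and "line_through p y \<inter> line_through p z = {}"
    and "line_through x y = line_through p y \<union> line_through y z"
    and "line_through p y \<inter> line_through y z = {}"
proof -
  have tw: "tword (w @ [a])" "tword (w @ [b])" using t o by (auto simp: tword_snoc_iff)
  have nb: "tadj x v \<longleftrightarrow> v = p \<or> v = y \<or> v = z" for v
    unfolding x_def p_def y_def z_def using tadj_Abs_iff[OF t ne] o by auto
  have dist: "p \<noteq> y" "p \<noteq> z" "y \<noteq> z"
    using tw t ab by (auto simp: p_def y_def z_def Abs_tvert_eq_iff tword_butlast dest: arg_cong[of _ _ length])
  have ex: "(p \<in> L \<and> y \<in> L \<and> z \<notin> L) \<or> (p \<in> L \<and> z \<in> L \<and> y \<notin> L) \<or> (y \<in> L \<and> z \<in> L \<and> p \<notin> L)"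
    if L: "L \<in> tlines" and x: "x \<in> L" for L
  proof -
    obtain c d where cd: "c \<noteq> d" "{w \<in> L. tadj x w} = {c, d}"
      using tline_neighbours[OF L x] by metis
    have "{w \<in> L. tadj x w} = L \<inter> {p, y, z}" using nb by auto
    then have e: "L \<inter> {p, y, z} = {c, d}" using cd by simp
    then have "c \<in> {p, y, z}" "d \<in> {p, y, z}" by auto
    then show ?thesis using e cd(1) dist by auto
  qed
  have px: "x \<in> L" if "L \<in> tlines" "p \<in> L" "Abs_tvert (w @ [c]) \<in> L" "tword (w @ [c])" for L c
  proof -
    have e: "butlast w @ [last w, c] = w @ [c]" using ne
      by (metis append.assoc append_Cons append_Nil append_butlast_last_id)
    show ?thesis
      using line_through_parent_in[OF that(1), of "butlast w" "[last w, c]", unfolded e] that ne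
      by (simp add: p_def x_def)
  qed
  have py: "x \<in> L" if "L \<in> tlines" "p \<in> L" "y \<in> L" for L
    using px[of L a] that tw by (auto simp: y_def)
  have pz: "x \<in> L" if "L \<in> tlines" "p \<in> L" "z \<in> L" for L
    using px[of L b] that tw by (auto simp: z_def)
  have yz: "x \<in> L" if "L \<in> tlines" "y \<in> L" "z \<in> L" for L
    using line_through_siblings_apex[OF that(1) tw ab] that by (simp add: x_def y_def z_def)
  show "line_through p x = line_through p y \<union> line_through p z"
    using ex py pz by (fastforce simp: line_through_def)
  show "line_through p y \<inter> line_through p z = {}"
    using ex py by (fastforce simp: line_through_def)
  show "line_through x y = line_through p y \<union> line_through y z"
    using ex py yz by (fastforce simp: line_through_def)
  show "line_through p y \<inter> line_through y z = {}"
    using ex py by (fastforce simp: line_through_def)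
qed

text \<open>At each further vertex the line already contains the parent, so its second neighbour
  there is a child.\<close>

lemma line_through_descend:
  assumes L: "L \<in> tlines" and w: "tword (w @ [a])" and "Abs_tvert w \<in> L" "Abs_tvert (w @ [a]) \<in> L"
  shows "\<exists>v. length v = k \<and> tword (w @ a # v) \<and> Abs_tvert (w @ a # v) \<in> L"
proof (induction k)
  case 0
  then show ?case using assms by auto
next
  case (Suc k)
  then obtain v where v: "length v = k" "tword (w @ a # v)" "Abs_tvert (w @ a # v) \<in> L" by auto
  let ?u = "w @ a # v"
  have "Abs_tvert (w @ butlast (a # v)) \<in> L"
    using line_through_parent_in[OF L, of w "a # v"] v assms by simp
  moreover have "butlast ?u = w @ butlast (a # v)" by (simp add: butlast_append)
  ultimately have p: "Abs_tvert (butlast ?u) \<in> L" by simp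
  obtain c where "c \<noteq> Abs_tvert (butlast ?u)" "{z \<in> L. tadj (Abs_tvert ?u) z} = {Abs_tvert (butlast ?u), c}"
    using tline_two_neighbours[OF L v(3) tadj_parent[OF v(2)] p] by auto
  then have "c \<in> L" "c \<noteq> Abs_tvert (butlast ?u)" "tadj (Abs_tvert ?u) c" by auto
  then obtain d where "d \<in> other_letters ?u" "Abs_tvert (?u @ [d]) \<in> L"
    using tadj_Abs_iff[OF v(2)] by auto
  then show ?case using v by (intro exI[of _ "v @ [d]"]) (auto simp: tword_snoc_iff simp flip: append_assoc append_Cons)
qed

section \<open>Void events of a Poisson process\<close>

lemma poisson_mean_term:
  fixes l c :: real
  shows "of_nat (Suc k) * (l ^ Suc k / fact (Suc k) * c) = (l ^ k / fact k) * (l * c)"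
proof -
  have "x * (l * p / (x * f) * c) = p / f * (l * c)" if "x \<noteq> 0" for x p f :: real
    using that by (simp add: divide_simps)
  then show ?thesis
    unfolding fact_Suc power_Suc of_nat_mult of_nat_fact by (metis of_nat_eq_0_iff nat.distinct(1))
qed

lemma pcount_eq_0_iff: "pcount S A = 0 \<longleftrightarrow> S \<inter> A = {}"
  by (simp add: pcount_def emeasure_count_space_eq_0)

lemma pcount_Un_disjoint: "A \<inter> B = {} \<Longrightarrow> pcount S (A \<union> B) = pcount S A + pcount S B"
  unfolding pcount_def Int_Un_distrib by (subst plus_emeasure) auto

lemma pcount_eq_top: "pcount S A = \<infinity> \<Longrightarrow> S \<inter> A \<noteq> {}"
  by (metis pcount_eq_0_iff ennreal_zero_neq_top infinity_ennreal_def)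

lemma one_le_pcount: "S \<inter> A \<noteq> {} \<Longrightarrow> 1 \<le> pcount S A"
  using of_nat_mono[of 1 "card (S \<inter> A)", where ?'a = ennreal]
  by (cases "finite (S \<inter> A)") (auto simp: pcount_def emeasure_count_space card_gt_0_iff Suc_le_eq)

locale poisson_roads =
  fixes P :: "'w measure" and \<nu> :: "'a measure" and Roads :: "'w \<Rightarrow> 'a set"
  assumes poisson: "poisson_process P \<nu> Roads"
begin

sublocale prob_space P
  using poisson by (simp add: poisson_process_def)

definition void :: "'a set \<Rightarrow> 'w set" where
  "void A = {\<omega> \<in> space P. Roads \<omega> \<inter> A = {}}"

text \<open>The information carried by the roads in \<open>R\<close>, which may be any set. Void
  events suffice as generators because the later constructions only ask whether given sets contain a
  road.\<close>

definition void_algebra :: "'a set \<Rightarrow> 'w measure" where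
  "void_algebra R = sigma (space P) {void A | A. A \<in> sets \<nu> \<and> A \<subseteq> R}"

lemma Roads_subset: "\<omega> \<in> space P \<Longrightarrow> Roads \<omega> \<subseteq> space \<nu>"
  using poisson by (simp add: poisson_process_def)

lemma pcount_measurable: "A \<in> sets \<nu> \<Longrightarrow> (\<lambda>\<omega>. pcount (Roads \<omega>) A) \<in> borel_measurable P"
  using poisson by (simp add: poisson_process_def)

lemma prob_pcount:
  assumes "A \<in> sets \<nu>" "emeasure \<nu> A < \<infinity>"
  shows "prob {\<omega> \<in> space P. pcount (Roads \<omega>) A = of_nat k}
    = enn2real (emeasure \<nu> A) ^ k / fact k * exp (- enn2real (emeasure \<nu> A))"
proof -
  have "\<forall>A\<in>sets \<nu>. emeasure \<nu> A < \<infinity> \<longrightarrow>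
      (\<forall>k :: nat. prob {\<omega> \<in> space P. pcount (Roads \<omega>) A = of_nat k}
        = enn2real (emeasure \<nu> A) ^ k / fact k * exp (- enn2real (emeasure \<nu> A)))"
    using poisson unfolding poisson_process_def by (elim conjE) assumption
  from this[rule_format, OF assms] show ?thesis .
qed

lemma AE_pcount_infinite:
  "A \<in> sets \<nu> \<Longrightarrow> emeasure \<nu> A = \<infinity> \<Longrightarrow> AE \<omega> in P. pcount (Roads \<omega>) A = \<infinity>"
  using poisson by (simp add: poisson_process_def)

lemma void_eq: "void A = (\<lambda>\<omega>. pcount (Roads \<omega>) A) -` {0} \<inter> space P"
  by (auto simp: void_def pcount_eq_0_iff)

lemma void_events [measurable]: "A \<in> sets \<nu> \<Longrightarrow> void A \<in> events"
  unfolding void_eq using pcount_measurable by (rule measurable_sets) auto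

lemma void_Un: "void (A \<union> B) = void A \<inter> void B"
  by (auto simp: void_def)

lemma prob_void:
  assumes "A \<in> sets \<nu>" "emeasure \<nu> A < \<infinity>"
  shows "prob (void A) = exp (- enn2real (emeasure \<nu> A))"
proof -
  have "void A = {\<omega> \<in> space P. pcount (Roads \<omega>) A = of_nat 0}"
    by (auto simp: void_eq)
  then show ?thesis using prob_pcount[OF assms, of 0] by simp
qed

text \<open>The definition of the process gives the probabilities of the finite counts. They add up
  to 1, so the count is almost surely a natural number and its mean is that of the Poisson
  law.\<close>

lemma nn_integral_pcount:
  assumes A: "A \<in> sets \<nu>" and fin: "emeasure \<nu> A < \<infinity>"
  shows "(\<integral>\<^sup>+ \<omega>. pcount (Roads \<omega>) A \<partial>P) = emeasure \<nu> A"
proof -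
  define l where "l = enn2real (emeasure \<nu> A)"
  have l: "0 \<le> l" "ennreal l = emeasure \<nu> A" using fin by (auto simp: l_def)
  define D where "D k = {\<omega> \<in> space P. pcount (Roads \<omega>) A = of_nat k}" for k :: nat
  have D [measurable]: "D k \<in> events" for k
    unfolding D_def using pcount_measurable[OF A] by measurable
  have pD: "prob (D k) = l ^ k / fact k * exp (- l)" for k
    unfolding D_def l_def by (rule prob_pcount[OF A fin])
  have exp_sums: "(\<lambda>k. l ^ k / fact k) sums exp l"
    using exp_converges[of l] by (simp add: divide_inverse mult.commute)
  have disj: "disjoint_family D"
    by (auto simp: disjoint_family_on_def D_def)
  have "(\<lambda>k. prob (D k)) sums prob (\<Union>k. D k)"
    using disj by (intro finite_measure_UNION) auto
  moreover have "(\<lambda>k. prob (D k)) sums 1"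
    unfolding pD using sums_mult2[OF exp_sums, of "exp (- l)"] by (simp add: exp_minus)
  ultimately have "prob (\<Union>k. D k) = 1" by (rule sums_unique2)
  then have AE: "AE \<omega> in P. \<omega> \<in> (\<Union>k. D k)"
    by (subst (asm) prob_eq_1) auto
  have "(\<integral>\<^sup>+ \<omega>. pcount (Roads \<omega>) A \<partial>P) = (\<integral>\<^sup>+ \<omega>. (\<Sum>k. of_nat k * indicator (D k) \<omega>) \<partial>P)"
  proof (rule nn_integral_cong_AE, use AE in eventually_elim)
    fix \<omega> assume "\<omega> \<in> (\<Union>k. D k)"
    then obtain k where k: "\<omega> \<in> D k" by auto
    have "(\<Sum>j. of_nat j * indicator (D j) \<omega> :: ennreal) = (\<Sum>j. if j = k then of_nat k else 0)"
      using k disj by (intro suminf_cong) (auto simp: indicator_def disjoint_family_on_def)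
    also have "\<dots> = of_nat k" by (subst suminf_finite[of "{k}"]) auto
    finally show "pcount (Roads \<omega>) A = (\<Sum>j. of_nat j * indicator (D j) \<omega>)"
      using k by (simp add: D_def)
  qed
  also have "\<dots> = (\<Sum>k. of_nat k * emeasure P (D k))"
    by (subst nn_integral_suminf) (auto simp: nn_integral_cmult)
  also have "\<dots> = (\<Sum>k. ennreal (of_nat k * (l ^ k / fact k * exp (- l))))"
    using l by (intro suminf_cong) (simp add: emeasure_eq_measure pD ennreal_of_nat_eq_real_of_nat flip: ennreal_mult)
  also have "\<dots> = ennreal l"
  proof (rule sums_unique[symmetric], rule sums_ennreal[THEN iffD2])
    have "(\<lambda>k. of_nat (Suc k) * (l ^ Suc k / fact (Suc k) * exp (- l))) sums l"
    proof -
      have "exp l * (l * exp (- l)) = l" by (simp add: exp_minus)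
      from sums_mult2[OF exp_sums, of "l * exp (- l)", unfolded this]
      show ?thesis unfolding poisson_mean_term .
    qed
    then show "(\<lambda>k. of_nat k * (l ^ k / fact k * exp (- l))) sums l"
      \<comment> \<open>The term for k = 0 vanishes, so the shifted series has the same sum.\<close>
      using sums_Suc[of "\<lambda>k. of_nat k * (l ^ k / fact k * exp (- l))" l] by simp
  qed (use l in auto)
  finally show ?thesis using l by simp
qed

lemma space_void_algebra [simp]: "space (void_algebra R) = space P"
  by (simp add: void_algebra_def space_measure_of_conv)

lemma sets_void_algebra:
  "sets (void_algebra R) = sigma_sets (space P) {void A | A. A \<in> sets \<nu> \<and> A \<subseteq> R}"
  unfolding void_algebra_def by (intro sets_measure_of) (auto simp: void_def)

lemma void_in_void_algebra: "A \<in> sets \<nu> \<Longrightarrow> A \<subseteq> R \<Longrightarrow> void A \<in> sets (void_algebra R)"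
  by (auto simp: sets_void_algebra)

lemma void_algebra_mono: "R \<subseteq> R' \<Longrightarrow> sets (void_algebra R) \<subseteq> sets (void_algebra R')"
  unfolding sets_void_algebra by (intro sigma_sets_mono') auto

lemma void_algebra_events: "sets (void_algebra R) \<subseteq> events"
  unfolding sets_void_algebra by (intro sets.sigma_sets_subset) (auto simp: void_events)

lemma measurable_void_algebra: "f \<in> measurable (void_algebra R) M \<Longrightarrow> f \<in> measurable P M"
  using void_algebra_events by (auto simp: measurable_def)

lemma measurable_void_algebra_mono:
  "f \<in> measurable (void_algebra R) M \<Longrightarrow> R \<subseteq> R' \<Longrightarrow> f \<in> measurable (void_algebra R') M"
  using void_algebra_mono[of R R'] by (auto simp: measurable_def)

lemma pred_road_exists:
  assumes "A \<in> sets \<nu>" "A \<subseteq> R"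
  shows "Measurable.pred (void_algebra R) (\<lambda>\<omega>. Roads \<omega> \<inter> A \<noteq> {})"
proof -
  have "Measurable.pred (void_algebra R) (\<lambda>\<omega>. \<omega> \<notin> void A)"
    using void_in_void_algebra[OF assms] by measurable
  then show ?thesis by (rule measurable_cong[THEN iffD1, rotated]) (auto simp: void_def)
qed

text \<open>Both generating families are closed under intersection, so the product rule has to be
  checked only for one void event and one count event. There it is the independence of the counts of
  two disjoint sets.\<close>

lemma indep_void_algebra:
  assumes B: "B \<in> sets \<nu>" "B \<inter> R = {}"
  shows "indep_set (sets (void_algebra R))
    (sigma_sets (space P) {(\<lambda>\<omega>. pcount (Roads \<omega>) B) -` Q \<inter> space P | Q. Q \<in> sets borel})"
  unfolding sets_void_algebra
proof (rule indep_set_sigma_sets)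
  let ?V = "{void A | A. A \<in> sets \<nu> \<and> A \<subseteq> R}"
  let ?N = "{(\<lambda>\<omega>. pcount (Roads \<omega>) B) -` Q \<inter> space P | Q. Q \<in> sets borel}"
  show "Int_stable ?V"
  proof (rule Int_stableI)
    fix a b assume "a \<in> ?V" "b \<in> ?V"
    then obtain A A' where "a = void A" "b = void A'" "A \<in> sets \<nu>" "A' \<in> sets \<nu>" "A \<subseteq> R" "A' \<subseteq> R"
      by auto
    then show "a \<inter> b \<in> ?V" by (auto simp flip: void_Un intro!: exI[of _ "A \<union> A'"])
  qed
  show "Int_stable ?N"
  proof (rule Int_stableI)
    fix a b assume "a \<in> ?N" "b \<in> ?N"
    then obtain Q Q' where "a = (\<lambda>\<omega>. pcount (Roads \<omega>) B) -` Q \<inter> space P"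
      "b = (\<lambda>\<omega>. pcount (Roads \<omega>) B) -` Q' \<inter> space P" "Q \<in> sets borel" "Q' \<in> sets borel" by auto
    then show "a \<inter> b \<in> ?N" by (auto intro!: exI[of _ "Q \<inter> Q'"])
  qed
  show "indep_set ?V ?N"
  proof (rule indep_setI)
    show "?V \<subseteq> events" using void_events by auto
    show "?N \<subseteq> events" using measurable_sets[OF pcount_measurable[OF B(1)]] by auto
    fix a b assume "a \<in> ?V" "b \<in> ?N"
    then obtain A Q where a: "a = void A" "A \<in> sets \<nu>" "A \<subseteq> R"
      and b: "b = (\<lambda>\<omega>. pcount (Roads \<omega>) B) -` Q \<inter> space P" "Q \<in> sets borel" by auto
    \<comment> \<open>The two disjoint sets are indexed by 0 and 1 to match the independence clause
      of \<open>poisson_process\<close>.\<close>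
    define S where "S = (\<lambda>i::nat. if i = 0 then A else B)"
    define E :: "nat \<Rightarrow> ennreal set" where "E = (\<lambda>i. if i = 0 then {0} else Q)"
    have "indep_vars (\<lambda>_. borel) (\<lambda>i \<omega>. pcount (Roads \<omega>) (S i)) {0, 1}"
    proof -
      have "finite {0, 1::nat}" "\<forall>i\<in>{0, 1}. S i \<in> sets \<nu>" "disjoint_family_on S {0, 1}"
        using a B by (auto simp: S_def disjoint_family_on_def)
      then show ?thesis using poisson unfolding poisson_process_def by blast
    qed
    from indep_varsD_finite[OF this, of E] b
    have "prob (\<Inter>i\<in>{0, 1}. (\<lambda>\<omega>. pcount (Roads \<omega>) (S i)) -` E i \<inter> space P) =
      (\<Prod>i\<in>{0, 1}. prob ((\<lambda>\<omega>. pcount (Roads \<omega>) (S i)) -` E i \<inter> space P))"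
      by (auto simp: E_def)
    moreover have "(\<Inter>i\<in>{0, 1}. (\<lambda>\<omega>. pcount (Roads \<omega>) (S i)) -` E i \<inter> space P) = a \<inter> b"
      by (auto simp: a b void_eq S_def E_def)
    ultimately show "prob (a \<inter> b) = prob a * prob b"
      by (simp add: a b void_eq S_def E_def)
  qed
qed

lemma nn_integral_mult_pcount:
  assumes X: "X \<in> borel_measurable (void_algebra R)" and B: "B \<in> sets \<nu>" "B \<inter> R = {}"
    and fin: "emeasure \<nu> B < \<infinity>"
  shows "(\<integral>\<^sup>+ \<omega>. X \<omega> * pcount (Roads \<omega>) B \<partial>P) = (\<integral>\<^sup>+ \<omega>. X \<omega> \<partial>P) * emeasure \<nu> B"
proof -
  let ?Y = "\<lambda>\<omega>. pcount (Roads \<omega>) B"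
  have "indep_var borel X borel ?Y"
    unfolding indep_var_eq
  proof (intro conjI)
    show "random_variable borel X" by (rule measurable_void_algebra[OF X])
    show "random_variable borel ?Y" by (rule pcount_measurable[OF B(1)])
    have "sigma_sets (space P) {X -` A \<inter> space P |A. A \<in> sets borel} \<subseteq> sets (void_algebra R)"
      using measurable_sets[OF X] sets.sigma_sets_subset[of "{X -` A \<inter> space P |A. A \<in> sets borel}" "void_algebra R"]
      by auto
    note sub = this
    show "indep_set (sigma_sets (space P) {X -` A \<inter> space P |A. A \<in> sets borel})
        (sigma_sets (space P) {?Y -` A \<inter> space P |A. A \<in> sets borel})"
      unfolding indep_set_def
      by (rule indep_sets_mono_sets[OF indep_void_algebra[OF B, unfolded indep_set_def]])
        (use sub in \<open>auto split: bool.split\<close>)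
  qed
  moreover have "case_bool borel borel = (\<lambda>_. borel :: ennreal measure)"
    by (rule ext) (simp split: bool.split)
  ultimately have "indep_vars (\<lambda>_. borel) (case_bool X ?Y) UNIV"
    by (simp add: indep_var_def)
  from indep_vars_nn_integral[OF _ this] show ?thesis
    by (simp add: UNIV_bool nn_integral_pcount[OF B(1) fin] mult.commute)
qed

text \<open>The set to be tested is chosen at random by \<open>X\<close>, but \<open>X\<close>
  depends only on roads in \<open>R\<close>, which the sets \<open>B b\<close> avoid. Splitting over
  the countably many values of \<open>X\<close> leaves, for each value, a void event independent of
  the choice.\<close>

lemma prob_random_void_le:
  fixes X :: "'w \<Rightarrow> 'b::countable"
  assumes X: "X \<in> measurable (void_algebra R) (count_space UNIV)"
    and B: "\<And>b. B b \<in> sets \<nu>" "\<And>b. B b \<inter> R = {}"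
    and le: "\<And>b. b \<in> X ` space P \<Longrightarrow> prob (void (B b)) \<le> \<epsilon>"
  shows "{\<omega> \<in> space P. Roads \<omega> \<inter> B (X \<omega>) = {}} \<in> events"
    and "prob {\<omega> \<in> space P. Roads \<omega> \<inter> B (X \<omega>) = {}} \<le> \<epsilon>"
proof -
  have XP [measurable]: "X \<in> measurable P (count_space UNIV)" by (rule measurable_void_algebra[OF X])
  \<comment> \<open>Values of \<open>X\<close> are enumerated by their codes. Numbers that code no
    value get the empty set, which keeps the pieces disjoint.\<close>
  define F where "F n = (if n \<in> range (to_nat :: 'b \<Rightarrow> nat) then 
      X -` {from_nat n} \<inter> space P \<inter> void (B (from_nat n)) else {})" for n
  define G where "G n = (if n \<in> range (to_nat :: 'b \<Rightarrow> nat) then X -` {from_nat n} \<inter> space P else {})" for n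
  have Gv: "G n \<in> sets (void_algebra R)" for n
    using measurable_sets[OF X, of "{from_nat n}"] by (auto simp: G_def)
  have G: "G n \<in> events" for n using Gv void_algebra_events by auto
  have F_eq: "F n = G n \<inter> void (B (from_nat n))" for n by (auto simp: F_def G_def)
  have F: "F n \<in> events" for n unfolding F_eq using G void_events B by auto
  have disjG: "disjoint_family G" 
    by (auto simp: disjoint_family_on_def G_def)
  then have disjF: "disjoint_family F" by (auto simp: disjoint_family_on_def F_eq)
  have eq: "{\<omega> \<in> space P. Roads \<omega> \<inter> B (X \<omega>) = {}} = (\<Union>n. F n)"
    by (force simp: F_def void_def)
  show "{\<omega> \<in> space P. Roads \<omega> \<inter> B (X \<omega>) = {}} \<in> events"
    unfolding eq using F by auto
  have bound: "prob (F n) \<le> prob (G n) * \<epsilon>" for n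
  proof (cases "G n = {}")
    case False
    then have "from_nat n \<in> X ` space P" by (force simp: G_def split: if_splits)
    moreover have "prob (F n) = prob (G n) * prob (void (B (from_nat n)))"
      unfolding F_eq
    proof (rule indep_setD[OF indep_void_algebra[OF B]])
      show "G n \<in> sets (void_algebra R)" by (rule Gv)
      show "void (B (from_nat n)) \<in> sigma_sets (space P)
          {(\<lambda>\<omega>. pcount (Roads \<omega>) (B (from_nat n))) -` Q \<inter> space P |Q. Q \<in> sets borel}"
        unfolding void_eq by (intro sigma_sets.Basic) auto
    qed
    ultimately show ?thesis using le by (simp add: mult_left_mono)
  qed (simp add: F_eq)
  have sF: "(\<lambda>n. prob (F n)) sums prob (\<Union>n. F n)" using F disjF by (intro finite_measure_UNION) auto
  have sG: "(\<lambda>n. prob (G n)) sums prob (\<Union>n. G n)" using G disjG by (intro finite_measure_UNION) auto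
  have "(\<Union>n. G n) = space P" by (force simp: G_def)
  then have "(\<lambda>n. prob (G n) * \<epsilon>) sums \<epsilon>"
    using sums_mult2[OF sG, of \<epsilon>] by (simp add: prob_space)
  from sums_le[OF bound sF this] show "prob {\<omega> \<in> space P. Roads \<omega> \<inter> B (X \<omega>) = {}} \<le> \<epsilon>"
    by (simp add: eq)
qed

end

section \<open>Speeds and roads\<close>

definition speed_measure :: "real \<Rightarrow> real measure" where
  "speed_measure \<beta> = density (restrict_space lborel {0<..}) (\<lambda>v. ennreal ((\<beta> - 1) * v powr (- \<beta>)))"

lemma space_speed_measure [simp]: "space (speed_measure \<beta>) = {0<..}"
  by (simp add: speed_measure_def space_restrict_space)

lemma sets_speed_measure: "sets (speed_measure \<beta>) = sets (restrict_space borel {0<..})"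
  by (simp add: speed_measure_def sets_restrict_space)

lemma speed_measure_sets: "B \<in> sets borel \<Longrightarrow> B \<subseteq> {0<..} \<Longrightarrow> B \<in> sets (speed_measure \<beta>)"
  by (subst sets_speed_measure) (auto simp: sets_restrict_space_iff)

lemma sigma_finite_speed_measure: "sigma_finite_measure (speed_measure \<beta>)"
proof -
  interpret sigma_finite_measure "restrict_space lborel {0<..} :: real measure"
    by (rule sigma_finite_measure_restrict_space) (auto intro: lborel.sigma_finite_measure_axioms)
  show ?thesis
    unfolding speed_measure_def
    by (subst sigma_finite_iff_density_finite) (auto simp: measurable_restrict_space1)
qed

lemma emeasure_speed_tail:
  assumes \<beta>: "\<beta> > 1" and a: "a > 0"
  shows "emeasure (speed_measure \<beta>) {a<..} = ennreal (a powr (1 - \<beta>))"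
proof -
  have "emeasure (speed_measure \<beta>) {a<..} =
      (\<integral>\<^sup>+v. ennreal ((\<beta> - 1) * v powr (- \<beta>)) * indicator {a<..} v \<partial>restrict_space lborel {0<..})"
    unfolding speed_measure_def
    by (rule emeasure_density) (use a in \<open>auto simp: measurable_restrict_space1 sets_restrict_space_iff\<close>)
  also have "\<dots> = (\<integral>\<^sup>+v. ennreal ((\<beta> - 1) * v powr (- \<beta>)) * indicator {a<..} v * indicator {0<..} v \<partial>lborel)"
    by (subst nn_integral_restrict_space) auto
  \<comment> \<open>The null point \<open>a\<close> is added because the integration rule is for
    closed half-lines.\<close>
  also have "\<dots> = (\<integral>\<^sup>+v. ennreal ((\<beta> - 1) * v powr (- \<beta>)) * indicator {a..} v \<partial>lborel)"
    using a by (intro nn_integral_cong_AE AE_I[where N = "{a}"]) (auto split: split_indicator_asm)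
  also have "\<dots> = ennreal (0 - (- (a powr (1 - \<beta>))))"
  proof (rule nn_integral_FTC_atLeast)
    show "((\<lambda>x. - (x powr (1 - \<beta>))) \<longlongrightarrow> 0) at_top"
      using tendsto_minus[OF tendsto_neg_powr[OF _ filterlim_ident, of "1 - \<beta>"]] \<beta> by simp
    fix x assume "a \<le> x"
    then show "((\<lambda>x. - (x powr (1 - \<beta>))) has_real_derivative (\<beta> - 1) * x powr - \<beta>) (at x)"
      using a by (auto intro!: derivative_eq_intros simp: algebra_simps)
  qed (use \<beta> in auto)
  finally show ?thesis by simp
qed

lemma emeasure_speed_slab:
  assumes \<beta>: "\<beta> > 1" and a: "0 < a" "a \<le> b"
  shows "emeasure (speed_measure \<beta>) {a<..b} = ennreal (a powr (1 - \<beta>) - b powr (1 - \<beta>))"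
proof -
  have "emeasure (speed_measure \<beta>) ({a<..} - {b<..}) =
      emeasure (speed_measure \<beta>) {a<..} - emeasure (speed_measure \<beta>) {b<..}"
    using assms by (intro emeasure_Diff speed_measure_sets) (auto simp: emeasure_speed_tail)
  moreover have "{a<..} - {b<..} = {a<..b}" by auto
  ultimately show ?thesis
    using assms by (simp add: emeasure_speed_tail ennreal_minus)
qed

lemma emeasure_speed_top:
  assumes \<beta>: "\<beta> > 1"
  shows "emeasure (speed_measure \<beta>) {0<..} = \<infinity>"
proof (rule ccontr)
  assume "emeasure (speed_measure \<beta>) {0<..} \<noteq> \<infinity>"
  then obtain r where r: "emeasure (speed_measure \<beta>) {0<..} = ennreal r" "r \<ge> 0"
    by (cases "emeasure (speed_measure \<beta>) {0<..}") auto
  \<comment> \<open>Chosen so that the speeds above \<open>a\<close> alone have mass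
    \<open>r + 1\<close>.\<close>
  define a where "a = (r + 1) powr (1 / (1 - \<beta>))"
  have a: "a > 0" "a powr (1 - \<beta>) = r + 1"
    using r \<beta> by (auto simp: a_def powr_powr)
  have "emeasure (speed_measure \<beta>) {a<..} \<le> emeasure (speed_measure \<beta>) {0<..}"
    using a by (intro emeasure_mono speed_measure_sets) auto
  then show False using emeasure_speed_tail[OF \<beta> a(1)] r a by simp
qed

section \<open>Dyadic slabs of speeds\<close>

definition slab :: "nat \<Rightarrow> real set" where
  "slab k = {2 ^ k<..2 ^ Suc k}"

lemma slab_measurable: "slab k \<in> sets borel" and slab_pos: "slab k \<subseteq> {0<..}"
  by (auto simp: slab_def intro: less_trans[OF zero_less_power])

lemma slab_disjoint:
  assumes "m < n"
  shows "slab n \<inter> {..2 ^ Suc m} = {}"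
  using power_increasing[of "Suc m" n "2::real"] assms by (auto simp: slab_def)

definition slab_mass :: "real \<Rightarrow> nat \<Rightarrow> real" where
  "slab_mass \<beta> k = (1 - 2 powr (1 - \<beta>)) * (2 powr (1 - \<beta>)) ^ k"

lemma two_power_powr: "((2::real) ^ n) powr s = (2 powr s) ^ n"
proof -
  have "((2::real) ^ n) powr s = (2 powr real n) powr s" by (simp add: powr_realpow)
  also have "\<dots> = (2 powr s) powr real n" by (simp add: powr_powr mult.commute)
  also have "\<dots> = (2 powr s) ^ n" by (rule powr_realpow) simp
  finally show ?thesis .
qed

lemma emeasure_slab:
  assumes "\<beta> > 1"
  shows "emeasure (speed_measure \<beta>) (slab k) = ennreal (slab_mass \<beta> k)"
proof -
  have "emeasure (speed_measure \<beta>) (slab k) = ennreal ((2 ^ k) powr (1 - \<beta>) - (2 ^ Suc k) powr (1 - \<beta>))"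
    unfolding slab_def using assms by (intro emeasure_speed_slab) auto
  then show ?thesis
    unfolding two_power_powr slab_mass_def by (simp add: algebra_simps)
qed

lemma slab_mass_pos: "\<beta> > 1 \<Longrightarrow> slab_mass \<beta> k > 0"
  by (simp add: slab_mass_def powr_less_one)

lemma exists_slab:
  assumes "2 ^ k < (v::real)"
  obtains j where "j \<ge> k" "v \<in> slab j"
proof -
  obtain n where n: "v < 2 ^ n" using real_arch_pow[of 2 v] by auto
  define m where "m = (LEAST n. v \<le> 2 ^ n)"
  have m: "v \<le> 2 ^ m" unfolding m_def by (rule LeastI[of _ n]) (use n in simp)
  have "k < m" by (rule power_less_imp_less_exp[OF _ less_le_trans[OF assms m]]) simp
  then obtain j where j: "m = Suc j" "j \<ge> k" by (cases m) auto
  have "\<not> v \<le> 2 ^ j" using not_less_Least[of j "\<lambda>n. v \<le> 2 ^ n"] j by (simp add: m_def)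
  then show ?thesis using that[of j] j m by (auto simp: slab_def)
qed

section \<open>Roads over the tree and edge speeds\<close>

locale tree_roads =
  fixes \<beta> :: real and \<mu> :: "tvert set measure" and P :: "'w measure"
    and Roads :: "'w \<Rightarrow> (tvert set \<times> real) set"
  assumes beta: "\<beta> > 1"
    and line_measure: "line_measure \<mu>"
    and roads: "poisson_process P (road_intensity \<mu> \<beta>) Roads"
begin

sublocale poisson_roads P "road_intensity \<mu> \<beta>" Roads
  by unfold_locales (rule roads)

abbreviation "\<nu> \<equiv> road_intensity \<mu> \<beta>"

lemma road_intensity_eq: "\<nu> = \<mu> \<Otimes>\<^sub>M speed_measure \<beta>"
  by (simp add: road_intensity_def speed_measure_def)

lemma space_\<nu>: "space \<nu> = tlines \<times> {0<..}"
  using line_measure by (simp add: road_intensity_eq space_pair_measure line_measure_def)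

lemma road_in:
  assumes "\<omega> \<in> space P" "(L, v) \<in> Roads \<omega>"
  shows "L \<in> tlines" "v > 0"
  using Roads_subset[OF assms(1)] assms(2) space_\<nu> by auto

lemma line_through_sets: "x \<noteq> y \<Longrightarrow> line_through x y \<in> sets \<mu>"
  using line_measure by (auto simp: line_measure_def line_generators_def)

lemma road_set_sets:
  assumes "x \<noteq> y" "B \<in> sets borel" "B \<subseteq> {0<..}"
  shows "line_through x y \<times> B \<in> sets \<nu>"
  unfolding road_intensity_eq
  using line_through_sets[OF assms(1)] speed_measure_sets[OF assms(2,3)] by auto

lemma emeasure_road_set:
  assumes "x \<noteq> y" "B \<in> sets borel" "B \<subseteq> {0<..}"
  shows "emeasure \<nu> (line_through x y \<times> B) = ennreal ((1/2) ^ tdist x y) * emeasure (speed_measure \<beta>) B"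
proof -
  have "emeasure \<mu> (line_through x y) = ennreal ((1/2) ^ tdist x y)"
    using line_measure assms(1) by (auto simp: line_measure_def)
  then show ?thesis
    unfolding road_intensity_eq
    using sigma_finite_measure.emeasure_pair_measure_Times[OF sigma_finite_speed_measure
        line_through_sets[OF assms(1)] speed_measure_sets[OF assms(2,3)]] by simp
qed

lemma emeasure_road_slab:
  assumes "x \<noteq> y"
  shows "emeasure \<nu> (line_through x y \<times> slab k) = ennreal ((1/2) ^ tdist x y * slab_mass \<beta> k)"
  using slab_mass_pos[OF beta, of k]
  by (subst emeasure_road_set[OF assms slab_measurable slab_pos])
    (simp add: emeasure_slab[OF beta] ennreal_mult)

lemma road_slab_sets: "x \<noteq> y \<Longrightarrow> line_through x y \<times> slab k \<in> sets \<nu>"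
  by (rule road_set_sets[OF _ slab_measurable slab_pos])

definition edge_speeds :: "'w \<Rightarrow> tvert \<Rightarrow> tvert \<Rightarrow> real set" where
  "edge_speeds \<omega> x y = {v. \<exists>L. (L, v) \<in> Roads \<omega> \<and> x \<in> L \<and> y \<in> L}"

lemma edge_speed_eq: "edge_speed (Roads \<omega>) x y = Sup (edge_speeds \<omega> x y)"
  by (simp add: edge_speed_def edge_speeds_def)

lemma edge_speeds_iff:
  assumes "\<omega> \<in> space P"
  shows "v \<in> edge_speeds \<omega> x y \<longleftrightarrow> v > 0 \<and> Roads \<omega> \<inter> (line_through x y \<times> {v}) \<noteq> {}"
  using road_in[OF assms] by (auto simp: edge_speeds_def line_through_def)

text \<open>Low speeds have infinite mass, so the number of roads through both vertices is almost
  surely infinite, in particular nonzero.\<close>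

lemma AE_edge_speeds_nonempty:
  assumes "x \<noteq> y"
  shows "AE \<omega> in P. edge_speeds \<omega> x y \<noteq> {}"
proof -
  have "emeasure \<nu> (line_through x y \<times> {0<..}) = \<infinity>"
    using assms by (subst emeasure_road_set) (auto simp: emeasure_speed_top[OF beta] ennreal_mult_top)
  then have "AE \<omega> in P. pcount (Roads \<omega>) (line_through x y \<times> {0<..}) = \<infinity>"
    using assms by (intro AE_pcount_infinite road_set_sets) auto
  then show ?thesis
    using AE_space
  proof eventually_elim
    case (elim \<omega>)
    then show ?case using pcount_eq_top[OF elim(1)] edge_speeds_iff[OF elim(2)] by blast
  qed
qed

text \<open>The probability that no road through both vertices is faster than 2^k tends to 1 as k
  grows.\<close>

lemma AE_edge_speeds_bounded:
  assumes xy: "x \<noteq> y"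
  shows "AE \<omega> in P. bdd_above (edge_speeds \<omega> x y)"
proof -
  define A where "A k = line_through x y \<times> {2 ^ k :: real<..}" for k :: nat
  have A: "A k \<in> sets \<nu>" "emeasure \<nu> (A k) = ennreal ((1/2) ^ tdist x y * (2 ^ k) powr (1 - \<beta>))" for k
  proof -
    have B: "{2 ^ k :: real<..} \<subseteq> {0<..}" by (auto intro: less_trans[OF zero_less_power])
    show "A k \<in> sets \<nu>" unfolding A_def using B xy by (intro road_set_sets) auto
    show "emeasure \<nu> (A k) = ennreal ((1/2) ^ tdist x y * (2 ^ k) powr (1 - \<beta>))"
      unfolding A_def using B xy by (subst emeasure_road_set) (auto simp: emeasure_speed_tail[OF beta] ennreal_mult)
  qed
  have "prob (void (A k)) \<le> prob (\<Union>k. void (A k))" for k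
    by (intro finite_measure_mono) (auto simp: void_events A)
  moreover have "(\<lambda>k. prob (void (A k))) \<longlonglongrightarrow> 1"
  proof -
    have "prob (void (A k)) = exp (- ((1/2) ^ tdist x y * (2 ^ k) powr (1 - \<beta>)))" for k
      using prob_void[OF A(1)] A(2) by simp
    moreover have "(\<lambda>k. exp (- ((1/2) ^ tdist x y * (2 ^ k :: real) powr (1 - \<beta>)))) \<longlonglongrightarrow> exp (- ((1/2) ^ tdist x y * 0))"
      unfolding two_power_powr using beta by (intro tendsto_intros LIMSEQ_realpow_zero) (auto simp: powr_less_one)
    ultimately show ?thesis by simp
  qed
  ultimately have "1 \<le> prob (\<Union>k. void (A k))"
    by (intro LIMSEQ_le_const2) auto
  then have "prob (\<Union>k. void (A k)) = 1" using prob_le_1 antisym by blast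
  then have "AE \<omega> in P. \<omega> \<in> (\<Union>k. void (A k))"
    by (subst (asm) prob_eq_1) (auto simp: void_events A)
  then show ?thesis
  proof eventually_elim
    case (elim \<omega>)
    then obtain k where k: "\<omega> \<in> void (A k)" by auto
    then have "\<omega> \<in> space P" by (simp add: void_def)
    have "v \<le> 2 ^ k" if "v \<in> edge_speeds \<omega> x y" for v
    proof (rule ccontr)
      assume "\<not> v \<le> 2 ^ k"
      then have "Roads \<omega> \<inter> A k \<noteq> {}"
        using that edge_speeds_iff[OF \<open>\<omega> \<in> space P\<close>] by (auto simp: A_def)
      then show False using k by (simp add: void_def)
    qed
    then show ?case by (auto simp: bdd_above_def)
  qed
qed

text \<open>\<open>edge_speed\<close> is a real supremum, which is meaningful only for nonempty sets
  that are bounded above.\<close>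

definition regular :: "'w \<Rightarrow> bool" where
  "regular \<omega> \<longleftrightarrow> (\<forall>x y. x \<noteq> y \<longrightarrow> edge_speeds \<omega> x y \<noteq> {} \<and> bdd_above (edge_speeds \<omega> x y))"

lemma AE_regular: "AE \<omega> in P. regular \<omega>"
proof -
  \<comment> \<open>The quantifiers range over words because \<open>nat list\<close> is a countable
    type.\<close>
  have "AE \<omega> in P. \<forall>u w :: nat list. Abs_tvert u \<noteq> Abs_tvert w \<longrightarrow>
      edge_speeds \<omega> (Abs_tvert u) (Abs_tvert w) \<noteq> {} \<and> bdd_above (edge_speeds \<omega> (Abs_tvert u) (Abs_tvert w))"
    unfolding AE_all_countable
    using AE_edge_speeds_nonempty AE_edge_speeds_bounded by (auto intro!: AE_impI simp: AE_conj_iff)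
  then show ?thesis
  proof eventually_elim
    case (elim \<omega>)
    then show ?case unfolding regular_def by (metis Rep_tvert_inverse)
  qed
qed

end

section \<open>Speed exponent above 2\<close>

lemma ennreal_two_times_half: "2 * ennreal (1/2) = 1"
proof -
  have "2 * ennreal (1/2) = ennreal 2 * ennreal (1/2)" by simp
  also have "\<dots> = 1" by (subst ennreal_mult[symmetric]) auto
  finally show ?thesis .
qed

text \<open>Speeds up to 2^k0 are treated alike; a faster road in \<open>slab (k0 + j)\<close>
  counts with weight 2^(k0+j+4). The second bound in \<open>theta\<close> serves edges without fast
  roads. By \<open>mass_le\<close> the fast roads turning at a vertex have expected total weight at
  most 1/2; the 1/4 is the measure of the lines through two siblings.\<close>

locale slow_tree_roads = tree_roads \<beta> \<mu> P Roads
  for \<beta> \<mu> and P :: "'w measure" and Roads +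
  fixes k0 :: nat and \<theta> :: real
  assumes theta: "\<theta> \<ge> 1" "3 * exp (- \<theta> * (1/2) ^ k0) \<le> 1/2"
    and mass_le: "(\<Sum>j. ennreal (2 ^ (k0 + j + 4)) * ennreal (1/4 * slab_mass \<beta> (k0 + j))) \<le> ennreal (1/2)"
begin

definition road_sum :: "'w \<Rightarrow> tvert \<Rightarrow> tvert \<Rightarrow> ennreal" where
  "road_sum \<omega> x y = (\<Sum>j. ennreal (2 ^ (k0 + j + 4)) * pcount (Roads \<omega>) (line_through x y \<times> slab (k0 + j)))"

text \<open>Index 0 is the baseline for edges without fast roads; index \<open>Suc j\<close> records
  that \<open>slab (k0 + j)\<close> is occupied, using its largest speed 2^(k0+j+1). Over occupied
  slabs the values increase with the index, so the supremum reflects the fastest roads.\<close>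

definition slab_weight :: "'w \<Rightarrow> tvert \<Rightarrow> tvert \<Rightarrow> nat \<Rightarrow> ennreal" where
  "slab_weight \<omega> x y n = (case n of 0 \<Rightarrow> ennreal (exp (- \<theta> * (1/2) ^ k0))
     | Suc j \<Rightarrow> (if Roads \<omega> \<inter> (line_through x y \<times> slab (k0 + j)) \<noteq> {} then ennreal (exp (- \<theta> * (1/2) ^ (k0 + j + 1))) else 0))"

text \<open>An upper bound for the Laplace weight \<open>exp (- \<theta> / V)\<close> of an edge with speed \<open>V\<close>,
  with the speed rounded up to a dyadic value.\<close>

definition edge_weight :: "'w \<Rightarrow> tvert \<Rightarrow> tvert \<Rightarrow> ennreal" where
  "edge_weight \<omega> x y = (SUP n. slab_weight \<omega> x y n)"

lemma slab_weight_le_1: "slab_weight \<omega> x y n \<le> 1"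
  using theta by (auto simp: slab_weight_def split: nat.split)

lemma edge_weight_le_1: "edge_weight \<omega> x y \<le> 1"
  unfolding edge_weight_def by (rule SUP_least) (rule slab_weight_le_1)

text \<open>Let N = 2^(k0+j+1). One road in the slab contributes 8 N to the sum, and the factor
  \<open>c\<close> removes at least the share 1/(N+1) of the sum, hence at least 8 N/(N+1) >= 4. The
  additive form avoids subtraction in \<open>ennreal\<close>, where the sum may be infinite.\<close>

lemma slab_weight_drift:
  assumes road: "Roads \<omega> \<inter> (line_through x y \<times> slab (k0 + j)) \<noteq> {}"
    and c: "c \<le> ennreal (exp (- \<theta> * (1/2) ^ (k0 + j + 1)))"
  shows "c * road_sum \<omega> x y + 4 \<le> road_sum \<omega> x y"
proof -
  let ?S = "road_sum \<omega> x y"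
  define q where "q = exp (- \<theta> * (1/2) ^ (k0 + j + 1))"
  have q: "0 \<le> q" "q \<le> 1" using theta by (auto simp: q_def)
  define N :: real where "N = 2 ^ (k0 + j + 1)"
  have N: "N \<ge> 1" unfolding N_def by (rule one_le_power) simp
  have "exp (- \<theta> * (1/2) ^ (k0 + j + 1)) \<le> exp (- (1 / N))"
    using theta(1) N by (simp add: N_def power_one_over divide_simps del: power_Suc)
  \<comment> \<open>This is e^x >= 1 + x at x = 1/N.\<close>
  also have "\<dots> \<le> 1 / (1 + 1 / N)"
    using exp_ge_add_one_self[of "1 / N"] N by (simp add: exp_minus field_simps add_pos_pos)
  finally have "q \<le> N / (N + 1)" using N by (simp add: q_def field_simps)
  then have "1 - q \<ge> 1 / (N + 1)" using N by (simp add: field_simps)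
  then have "(1 - q) * (8 * N) \<ge> 1 / (N + 1) * (8 * N)" using N by (intro mult_right_mono) auto
  moreover have "1 / (N + 1) * (8 * N) \<ge> 4" using N by (simp add: field_simps)
  moreover have "(2::real) ^ (k0 + j + 4) = 8 * N" by (simp add: N_def power_add)
  ultimately have four: "4 \<le> (1 - q) * 2 ^ (k0 + j + 4)" by (metis order_trans)
  let ?t = "\<lambda>j. ennreal (2 ^ (k0 + j + 4)) * pcount (Roads \<omega>) (line_through x y \<times> slab (k0 + j))"
  have "ennreal (2 ^ (k0 + j + 4)) \<le> ?t j"
    using mult_left_mono[OF one_le_pcount[OF road], of "ennreal (2 ^ (k0 + j + 4))"] by simp
  also have "?t j \<le> ?S"
    unfolding road_sum_def using sum_le_suminf[OF summableI, of "{j}" ?t] by simp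
  finally have le: "ennreal (2 ^ (k0 + j + 4)) \<le> ?S" .
  have "4 = ennreal 4" by simp
  also have "\<dots> \<le> ennreal ((1 - q) * 2 ^ (k0 + j + 4))" using four by (intro ennreal_leI)
  also have "\<dots> = ennreal (1 - q) * ennreal (2 ^ (k0 + j + 4))" using q by (intro ennreal_mult) auto
  also have "\<dots> \<le> ennreal (1 - q) * ?S" using le by (intro mult_left_mono) auto
  finally have "c * ?S + 4 \<le> ennreal q * ?S + ennreal (1 - q) * ?S"
    using c by (intro add_mono mult_right_mono) (auto simp: q_def)
  also have "\<dots> = (ennreal q + ennreal (1 - q)) * ?S" by (simp add: distrib_right)
  also have "ennreal q + ennreal (1 - q) = 1" using q by (simp flip: ennreal_plus)
  finally show ?thesis by simp
qed

text \<open>The 3 stands for a 1 from each of two children and a 1 for the roads turning at the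
  vertex; the 1/2 is the surplus to be summed over the tree. With a fast road present, the loss of 4
  from the sum pays for both. Without one the sum is 0 and the claim is the bound on
  \<theta>.\<close>

lemma edge_weight_drift:
  "edge_weight \<omega> x y * (3 + road_sum \<omega> x y) + ennreal (1/2) \<le> 1 + road_sum \<omega> x y"
proof (cases "\<exists>j. Roads \<omega> \<inter> (line_through x y \<times> slab (k0 + j)) \<noteq> {}")
  case True
  then obtain j where j: "Roads \<omega> \<inter> (line_through x y \<times> slab (k0 + j)) \<noteq> {}" ..
  let ?S = "road_sum \<omega> x y" and ?r = "edge_weight \<omega> x y"
  have w: "slab_weight \<omega> x y n * ?S + 4 \<le> ?S" for n
  proof (cases n)
    case 0
    have "exp (- \<theta> * (1/2) ^ k0) \<le> exp (- \<theta> * (1/2) ^ (k0 + j + 1))"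
      using theta(1) power_decreasing[of k0 "k0 + j + 1" "1/2::real"] by simp
    then show ?thesis using slab_weight_drift[OF j] 0 by (simp add: slab_weight_def)
  next
    case (Suc i)
    show ?thesis
    proof (cases "Roads \<omega> \<inter> (line_through x y \<times> slab (k0 + i)) \<noteq> {}")
      case True
      then show ?thesis using slab_weight_drift[OF True] Suc by (simp add: slab_weight_def)
    next
      case False
      then show ?thesis using slab_weight_drift[OF j, of 0] Suc by (simp add: slab_weight_def)
    qed
  qed
  have "?r * ?S + 4 = (SUP n. slab_weight \<omega> x y n * ?S + 4)"
    unfolding edge_weight_def by (simp add: SUP_mult_right_ennreal ennreal_SUP_add_left)
  also have "\<dots> \<le> ?S" using w by (intro SUP_least)
  finally have S: "?r * ?S + 4 \<le> ?S" .
  have "?r * 3 + ennreal (1/2) \<le> 1 * 3 + ennreal 1"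
    using edge_weight_le_1 by (intro add_mono mult_right_mono ennreal_leI) auto
  also have "\<dots> = 4" by simp
  finally have "?r * 3 + ennreal (1/2) \<le> 4" .
  then have "?r * ?S + (?r * 3 + ennreal (1/2)) \<le> ?r * ?S + 4" by (rule add_left_mono)
  then have "?r * (3 + ?S) + ennreal (1/2) \<le> ?r * ?S + 4" by (simp add: distrib_left ac_simps)
  also have "\<dots> \<le> ?S" by (rule S)
  also have "\<dots> \<le> 1 + ?S" by simp
  finally show ?thesis .
next
  case False
  then have "pcount (Roads \<omega>) (line_through x y \<times> slab (k0 + j)) = 0" for j
    using pcount_eq_0_iff by blast
  then have "road_sum \<omega> x y = 0" by (simp add: road_sum_def)
  moreover have "edge_weight \<omega> x y = ennreal (exp (- \<theta> * (1/2) ^ k0))"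
  proof -
    have "slab_weight \<omega> x y n \<le> slab_weight \<omega> x y 0" for n
      using False by (auto simp: slab_weight_def split: nat.split)
    then have "edge_weight \<omega> x y = slab_weight \<omega> x y 0"
      unfolding edge_weight_def by (intro antisym SUP_least SUP_upper) auto
    then show ?thesis by (simp add: slab_weight_def)
  qed
  moreover have "ennreal (exp (- \<theta> * (1/2) ^ k0)) * 3 + ennreal (1/2) \<le> 1"
  proof -
    define e where "e = exp (- \<theta> * (1/2) ^ k0)"
    have "ennreal (e * 3 + 1/2) = ennreal (e * 3) + ennreal (1/2)"
      by (rule ennreal_plus) (auto simp: e_def)
    moreover have "ennreal (e * 3) = ennreal e * ennreal 3"
      by (rule ennreal_mult) (auto simp: e_def)
    ultimately have "ennreal e * 3 + ennreal (1/2) = ennreal (e * 3 + 1/2)" by simp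
    also have "\<dots> \<le> ennreal 1" using theta(2) by (intro ennreal_leI) (simp add: e_def)
    finally show ?thesis by (simp add: e_def)
  qed
  ultimately show ?thesis by simp
qed

lemma edge_weight_ge:
  assumes \<omega>: "\<omega> \<in> space P" "regular \<omega>" and xy: "x \<noteq> y"
  shows "edge_speed (Roads \<omega>) x y > 0"
    and "ennreal (exp (- \<theta> * (1 / edge_speed (Roads \<omega>) x y))) \<le> edge_weight \<omega> x y"
proof -
  let ?E = "edge_speeds \<omega> x y"
  define V where "V = Sup ?E"
  have E: "?E \<noteq> {}" "bdd_above ?E" using \<omega>(2) xy by (auto simp: regular_def)
  have V_ge: "v \<le> V" if "v \<in> ?E" for v unfolding V_def using that E(2) by (rule cSup_upper)
  obtain v where v: "v \<in> ?E" using E by auto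
  have V: "V > 0" using V_ge[OF v] v edge_speeds_iff[OF \<omega>(1)] by force
  then show "edge_speed (Roads \<omega>) x y > 0" by (simp add: edge_speed_eq V_def)
  have "\<exists>n. ennreal (exp (- \<theta> * (1 / V))) \<le> slab_weight \<omega> x y n"
  proof (cases "V \<le> 2 ^ k0")
    case True
    have "exp (- \<theta> * (1 / V)) \<le> exp (- \<theta> * (1/2) ^ k0)"
      using True V theta(1) by (simp add: power_one_over frac_le)
    then have "ennreal (exp (- \<theta> * (1 / V))) \<le> slab_weight \<omega> x y 0"
      by (simp add: slab_weight_def ennreal_leI)
    then show ?thesis ..
  next
    case False
    then obtain i where i: "i \<ge> k0" "V \<in> slab i" using exists_slab[of k0 V] by auto
    then obtain j where j: "i = k0 + j" using le_Suc_ex by blast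
    have V': "2 ^ i < V" "V \<le> 2 ^ Suc i" using i by (auto simp: slab_def)
    \<comment> \<open>The supremum \<open>V\<close> is not known to be attained, but some road
      faster than 2^i lies in the same slab as \<open>V\<close>.\<close>
    obtain v where v: "v \<in> ?E" "2 ^ i < v" using less_cSupE[of "2 ^ i" ?E] V' E by (auto simp: V_def)
    then have "v \<in> slab (k0 + j)" using V_ge[OF v(1)] V' j by (auto simp: slab_def)
    then have "Roads \<omega> \<inter> (line_through x y \<times> slab (k0 + j)) \<noteq> {}"
      using v edge_speeds_iff[OF \<omega>(1)] by blast
    then have w: "slab_weight \<omega> x y (Suc j) = ennreal (exp (- \<theta> * (1/2) ^ (k0 + j + 1)))"
      by (simp add: slab_weight_def)
    have "1 / V \<ge> 1 / 2 ^ (k0 + j + 1)" using V' V j by (intro divide_left_mono) auto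
    then have "exp (- \<theta> * (1 / V)) \<le> exp (- \<theta> * (1/2) ^ (k0 + j + 1))"
      using theta(1) mult_left_mono[of "1 / 2 ^ (k0 + j + 1)" "1 / V" \<theta>] by (simp add: power_one_over)
    then have "ennreal (exp (- \<theta> * (1 / V))) \<le> slab_weight \<omega> x y (Suc j)"
      unfolding w by (rule ennreal_leI)
    then show ?thesis ..
  qed
  then show "ennreal (exp (- \<theta> * (1 / edge_speed (Roads \<omega>) x y))) \<le> edge_weight \<omega> x y"
    unfolding edge_weight_def edge_speed_eq V_def by (meson SUP_upper2 UNIV_I)
qed

lemma edge_weight_measurable:
  assumes "x \<noteq> y" "line_through x y \<times> {0<..} \<subseteq> R"
  shows "(\<lambda>\<omega>. edge_weight \<omega> x y) \<in> borel_measurable (void_algebra R)"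
  unfolding edge_weight_def
proof (rule borel_measurable_SUP)
  fix n :: nat
  show "(\<lambda>\<omega>. slab_weight \<omega> x y n) \<in> borel_measurable (void_algebra R)"
  proof (cases n)
    case (Suc j)
    have [measurable]: "Measurable.pred (void_algebra R) (\<lambda>\<omega>. Roads \<omega> \<inter> (line_through x y \<times> slab (k0 + j)) \<noteq> {})"
      using assms slab_pos by (intro pred_road_exists road_slab_sets) blast+
    show ?thesis unfolding slab_weight_def Suc by simp
  qed (simp add: slab_weight_def)
qed simp

lemma road_sum_measurable:
  assumes xy: "x \<noteq> y"
  shows "(\<lambda>\<omega>. road_sum \<omega> x y) \<in> borel_measurable P"
proof -
  have [measurable]: "(\<lambda>\<omega>. pcount (Roads \<omega>) (line_through x y \<times> slab j)) \<in> borel_measurable P" for j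
    by (intro pcount_measurable road_slab_sets xy)
  show ?thesis unfolding road_sum_def by measurable
qed

text \<open>Independence is applied slab by slab, each slab of roads through \<open>x\<close> and
  \<open>y\<close> being disjoint from \<open>R\<close>.\<close>

lemma nn_integral_mult_road_sum:
  assumes X: "X \<in> borel_measurable (void_algebra R)" and xy: "x \<noteq> y"
    and R: "(line_through x y \<times> {0<..}) \<inter> R = {}"
  shows "(\<integral>\<^sup>+ \<omega>. X \<omega> * road_sum \<omega> x y \<partial>P) = (\<integral>\<^sup>+ \<omega>. X \<omega> \<partial>P) *
    (\<Sum>j. ennreal (2 ^ (k0 + j + 4)) * ennreal ((1/2) ^ tdist x y * slab_mass \<beta> (k0 + j)))"
proof -
  have [measurable]: "X \<in> borel_measurable P" by (rule measurable_void_algebra[OF X])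
  have [measurable]: "(\<lambda>\<omega>. pcount (Roads \<omega>) (line_through x y \<times> slab j)) \<in> borel_measurable P" for j
    by (intro pcount_measurable road_slab_sets xy)
  have "(\<integral>\<^sup>+ \<omega>. X \<omega> * road_sum \<omega> x y \<partial>P) =
      (\<integral>\<^sup>+ \<omega>. (\<Sum>j. ennreal (2 ^ (k0 + j + 4)) * (X \<omega> * pcount (Roads \<omega>) (line_through x y \<times> slab (k0 + j)))) \<partial>P)"
    unfolding road_sum_def by (simp add: mult.left_commute flip: ennreal_suminf_cmult)
  also have "\<dots> = (\<Sum>j. ennreal (2 ^ (k0 + j + 4)) * (\<integral>\<^sup>+ \<omega>. X \<omega> * pcount (Roads \<omega>) (line_through x y \<times> slab (k0 + j)) \<partial>P))"
    by (simp add: nn_integral_suminf nn_integral_cmult)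
  also have "\<dots> = (\<Sum>j. ennreal (2 ^ (k0 + j + 4)) *
      ((\<integral>\<^sup>+ \<omega>. X \<omega> \<partial>P) * ennreal ((1/2) ^ tdist x y * slab_mass \<beta> (k0 + j))))"
  proof (intro suminf_cong arg_cong2[where f = "(*)"] refl)
    fix j
    have "(line_through x y \<times> slab (k0 + j)) \<inter> R = {}" using R slab_pos by blast
    then show "(\<integral>\<^sup>+ \<omega>. X \<omega> * pcount (Roads \<omega>) (line_through x y \<times> slab (k0 + j)) \<partial>P) =
       (\<integral>\<^sup>+ \<omega>. X \<omega> \<partial>P) * ennreal ((1/2) ^ tdist x y * slab_mass \<beta> (k0 + j))"
      using nn_integral_mult_pcount[OF X road_slab_sets[OF xy]] emeasure_road_slab[OF xy] by simp
  qed
  also have "\<dots> = (\<integral>\<^sup>+ \<omega>. X \<omega> \<partial>P) *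
    (\<Sum>j. ennreal (2 ^ (k0 + j + 4)) * ennreal ((1/2) ^ tdist x y * slab_mass \<beta> (k0 + j)))"
    by (simp add: mult.left_commute flip: ennreal_suminf_cmult)
  finally show ?thesis .
qed

section \<open>Expected drift along the tree\<close>

abbreviation word_weight :: "'w \<Rightarrow> nat list \<Rightarrow> ennreal" where
  "word_weight \<omega> w \<equiv> edge_weight \<omega> (Abs_tvert (butlast w)) (Abs_tvert w)"

abbreviation word_sum :: "'w \<Rightarrow> nat list \<Rightarrow> ennreal" where
  "word_sum \<omega> w \<equiv> road_sum \<omega> (Abs_tvert (butlast w)) (Abs_tvert w)"

text \<open>The weight of the path from the root to the parent of \<open>w\<close>, without its first edge\<close>

definition path_weight :: "'w \<Rightarrow> nat list \<Rightarrow> ennreal" where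
  "path_weight \<omega> w = (\<Prod>i\<in>{1..<length w}. word_weight \<omega> (take i w))"

text \<open>The path weight of a word leaves out the edge directly above it. That edge enters on
  passing to a child, which is where \<open>edge_weight_drift\<close> is applied to it.\<close>

lemma path_weight_snoc: "w \<noteq> [] \<Longrightarrow> path_weight \<omega> (w @ [a]) = path_weight \<omega> w * word_weight \<omega> w"
  by (cases "length w") (auto simp: path_weight_def intro!: prod.cong)

lemma butlast_neq: "tword w \<Longrightarrow> w \<noteq> [] \<Longrightarrow> Abs_tvert (butlast w) \<noteq> Abs_tvert w"
  by (metis Abs_tvert_eq_iff tword_butlast append_butlast_last_id append_self_conv not_Cons_self2)

lemma word_weight_measurable:
  assumes w: "tword w" "0 < i" "i \<le> length w"
    and R: "\<And>i. 0 < i \<Longrightarrow> i \<le> length w \<Longrightarrow>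
      line_through (Abs_tvert (take (i - 1) w)) (Abs_tvert (take i w)) \<times> {0<..} \<subseteq> R"
  shows "(\<lambda>\<omega>. word_weight \<omega> (take i w)) \<in> borel_measurable (void_algebra R)"
proof (rule edge_weight_measurable)
  show "Abs_tvert (butlast (take i w)) \<noteq> Abs_tvert (take i w)"
    using w by (intro butlast_neq tword_take) auto
  show "line_through (Abs_tvert (butlast (take i w))) (Abs_tvert (take i w)) \<times> {0<..} \<subseteq> R"
    using R[OF w(2,3)] w by (simp add: butlast_take)
qed

lemma path_weight_measurable:
  assumes w: "tword w"
    and R: "\<And>i. 0 < i \<Longrightarrow> i \<le> length w \<Longrightarrow>
      line_through (Abs_tvert (take (i - 1) w)) (Abs_tvert (take i w)) \<times> {0<..} \<subseteq> R"
  shows "(\<lambda>\<omega>. path_weight \<omega> w) \<in> borel_measurable (void_algebra R)"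
  unfolding path_weight_def
  by (intro borel_measurable_prod_ennreal word_weight_measurable w R) auto

lemma path_weight_borel: "tword w \<Longrightarrow> (\<lambda>\<omega>. path_weight \<omega> w) \<in> borel_measurable P"
  by (rule measurable_void_algebra[OF path_weight_measurable[of _ UNIV]]) auto

text \<open>A road over the edge above \<open>w\<close> continues to exactly one child and is
  counted once on either side. A road turning at \<open>w\<close> uses both child edges, hence the
  factor 2.\<close>

lemma road_sum_children:
  assumes t: "tword w" and ne: "w \<noteq> []" and o: "other_letters w = {a, b}" and ab: "a \<noteq> b"
  shows "word_sum \<omega> (w @ [a]) + word_sum \<omega> (w @ [b]) =
    word_sum \<omega> w + 2 * road_sum \<omega> (Abs_tvert (w @ [a])) (Abs_tvert (w @ [b]))"
proof -
  note s1 = line_through_split[OF t ne o ab]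
  have o': "other_letters w = {b, a}" using o by auto
  note s2 = line_through_split[OF t ne o' ab[symmetric]]
  let ?c = "\<lambda>x y j. pcount (Roads \<omega>) (line_through x y \<times> slab j)"
  let ?p = "Abs_tvert (butlast w)" and ?x = "Abs_tvert w" and ?y = "Abs_tvert (w @ [a])" and ?z = "Abs_tvert (w @ [b])"
  have split: "pcount S ((A \<union> B) \<times> C) = pcount S (A \<times> C) + pcount S (B \<times> C)" if "A \<inter> B = {}" for S and A B :: "tvert set set" and C :: "real set"
    using that by (subst Sigma_Un_distrib1, intro pcount_Un_disjoint) auto
  have "?c ?x ?y j + ?c ?x ?z j = ?c ?p ?x j + 2 * ?c ?y ?z j" for j
  proof -
    have "?c ?x ?y j = ?c ?p ?y j + ?c ?y ?z j" using s1(3,4) split by metis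
    moreover have "?c ?x ?z j = ?c ?p ?z j + ?c ?y ?z j"
      using s2(3,4) split line_through_commute[of ?y ?z] by metis
    moreover have "?c ?p ?x j = ?c ?p ?y j + ?c ?p ?z j" using s1(1,2) split by metis
    ultimately show ?thesis by (simp add: mult_2 ac_simps)
  qed
  note c = this
  let ?f = "\<lambda>j. ennreal (2 ^ (k0 + j + 4))"
  have term_eq: "?f j * ?c ?x ?y (k0 + j) + ?f j * ?c ?x ?z (k0 + j)
      = ?f j * ?c ?p ?x (k0 + j) + 2 * (?f j * ?c ?y ?z (k0 + j))" for j
    by (simp only: c distrib_left[symmetric] mult.left_commute[of 2])
  have "word_sum \<omega> (w @ [a]) + word_sum \<omega> (w @ [b])
      = (\<Sum>j. ?f j * ?c ?x ?y (k0 + j) + ?f j * ?c ?x ?z (k0 + j))"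
    unfolding road_sum_def butlast_snoc by (rule suminf_add[OF summableI summableI])
  also have "\<dots> = (\<Sum>j. ?f j * ?c ?p ?x (k0 + j)) + (\<Sum>j. 2 * (?f j * ?c ?y ?z (k0 + j)))"
    unfolding term_eq by (rule suminf_add[OF summableI summableI, symmetric])
  also have "\<dots> = word_sum \<omega> w + 2 * road_sum \<omega> ?y ?z"
    unfolding road_sum_def ennreal_suminf_cmult ..
  finally show ?thesis .
qed

text \<open>After expanding by \<open>road_sum_children\<close>, the roads turning at
  \<open>w\<close> are independent of the weights collected so far, so their doubled contribution is
  at most one further copy of the expected weight. Then \<open>edge_weight_drift\<close> applies
  pointwise.\<close>

lemma drift_step:
  assumes t: "tword w" and ne: "w \<noteq> []"
  shows "(\<Sum>a\<in>other_letters w. \<integral>\<^sup>+ \<omega>. path_weight \<omega> (w @ [a]) * (1 + word_sum \<omega> (w @ [a])) \<partial>P)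
      + ennreal (1/2) * (\<integral>\<^sup>+ \<omega>. path_weight \<omega> w \<partial>P)
    \<le> (\<integral>\<^sup>+ \<omega>. path_weight \<omega> w * (1 + word_sum \<omega> w) \<partial>P)"
proof -
  have "last w < 3" using t ne by (metis append_butlast_last_id tword_snoc)
  then have "\<exists>a. a \<in> other_letters w"
    by (intro exI[of _ "if last w = 0 then 1 else 0"]) (auto simp: other_letters_def)
  then obtain a b where ab: "a \<noteq> b" "other_letters w = {a, b}"
    using other_letters_nonempty_word[OF t ne] by metis
  let ?x = "Abs_tvert w" and ?y = "Abs_tvert (w @ [a])" and ?z = "Abs_tvert (w @ [b])"
  have tw: "tword (w @ [a])" "tword (w @ [b])" using t ab by (auto simp: tword_snoc_iff)
  have yz: "?y \<noteq> ?z" using tw ab by (simp add: Abs_tvert_eq_iff)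
  \<comment> \<open>Everything except the roads turning at \<open>w\<close>. It contains all roads
    over the path to \<open>w\<close>, so \<open>?X\<close> is measurable for
    \<open>void_algebra R\<close>.\<close>
  define R where "R = - (line_through ?y ?z \<times> {0 :: real<..})"
  have R: "line_through (Abs_tvert (take (i - 1) w)) (Abs_tvert (take i w)) \<times> {0<..} \<subseteq> R"
    if "0 < i" "i \<le> length w" for i
    using line_through_siblings_above[OF _ tw ab(1), of _ "i - 1"] that
    by (auto simp: R_def line_through_def)
  let ?X = "\<lambda>\<omega>. path_weight \<omega> w * word_weight \<omega> w"
  have wwR: "(\<lambda>\<omega>. word_weight \<omega> w) \<in> borel_measurable (void_algebra R)"
    using word_weight_measurable[OF t, of "length w"] ne R by simp
  have XR: "?X \<in> borel_measurable (void_algebra R)"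
    by (intro borel_measurable_times_ennreal path_weight_measurable t R wwR)
  have [measurable]: "(\<lambda>\<omega>. path_weight \<omega> w) \<in> borel_measurable P" by (rule path_weight_borel[OF t])
  have [measurable]: "(\<lambda>\<omega>. word_weight \<omega> w) \<in> borel_measurable P" by (rule measurable_void_algebra[OF wwR])
  have [measurable]: "(\<lambda>\<omega>. word_sum \<omega> w) \<in> borel_measurable P"
    by (intro road_sum_measurable butlast_neq t ne)
  have [measurable]: "(\<lambda>\<omega>. road_sum \<omega> ?x ?y) \<in> borel_measurable P" "(\<lambda>\<omega>. road_sum \<omega> ?x ?z) \<in> borel_measurable P"
    using butlast_neq[OF tw(1)] butlast_neq[OF tw(2)] by (auto intro!: road_sum_measurable)
  have [measurable]: "(\<lambda>\<omega>. road_sum \<omega> ?y ?z) \<in> borel_measurable P"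
    by (intro road_sum_measurable yz)
  have "(\<integral>\<^sup>+ \<omega>. ?X \<omega> * road_sum \<omega> ?y ?z \<partial>P) = (\<integral>\<^sup>+ \<omega>. ?X \<omega> \<partial>P) *
      (\<Sum>j. ennreal (2 ^ (k0 + j + 4)) * ennreal (1/4 * slab_mass \<beta> (k0 + j)))"
    using nn_integral_mult_road_sum[OF XR yz] tdist_siblings[OF tw ab(1)]
    by (simp add: R_def power2_eq_square)
  also have "\<dots> \<le> (\<integral>\<^sup>+ \<omega>. ?X \<omega> \<partial>P) * ennreal (1/2)"
    by (intro mult_left_mono mass_le) auto
  \<comment> \<open>The 1/2 of \<open>mass_le\<close> cancels the factor 2 of the turning
    roads.\<close>
  finally have cross: "2 * (\<integral>\<^sup>+ \<omega>. ?X \<omega> * road_sum \<omega> ?y ?z \<partial>P) \<le> (\<integral>\<^sup>+ \<omega>. ?X \<omega> \<partial>P)"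
  proof -
    assume le: "(\<integral>\<^sup>+ \<omega>. ?X \<omega> * road_sum \<omega> ?y ?z \<partial>P) \<le> (\<integral>\<^sup>+ \<omega>. ?X \<omega> \<partial>P) * ennreal (1/2)"
    have "2 * (\<integral>\<^sup>+ \<omega>. ?X \<omega> * road_sum \<omega> ?y ?z \<partial>P) \<le> 2 * ((\<integral>\<^sup>+ \<omega>. ?X \<omega> \<partial>P) * ennreal (1/2))"
      by (intro mult_left_mono le) auto
    also have "\<dots> = (\<integral>\<^sup>+ \<omega>. ?X \<omega> \<partial>P) * (2 * ennreal (1/2))" by (simp only: mult.left_commute)
    finally show ?thesis by (simp only: ennreal_two_times_half mult_1_right)
  qed
  have "(\<Sum>a\<in>other_letters w. \<integral>\<^sup>+ \<omega>. path_weight \<omega> (w @ [a]) * (1 + word_sum \<omega> (w @ [a])) \<partial>P)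
      = (\<integral>\<^sup>+ \<omega>. ?X \<omega> * (1 + road_sum \<omega> ?x ?y) \<partial>P) + (\<integral>\<^sup>+ \<omega>. ?X \<omega> * (1 + road_sum \<omega> ?x ?z) \<partial>P)"
    using ab ne by (simp add: path_weight_snoc)
  also have "\<dots> = (\<integral>\<^sup>+ \<omega>. ?X \<omega> * (1 + road_sum \<omega> ?x ?y) + ?X \<omega> * (1 + road_sum \<omega> ?x ?z) \<partial>P)"
    by (rule nn_integral_add[symmetric]) auto
  also have "\<dots> = (\<integral>\<^sup>+ \<omega>. ?X \<omega> * (2 + word_sum \<omega> w) + 2 * (?X \<omega> * road_sum \<omega> ?y ?z) \<partial>P)"
  proof (rule nn_integral_cong)
    fix \<omega>
    have "?X \<omega> * (1 + road_sum \<omega> ?x ?y) + ?X \<omega> * (1 + road_sum \<omega> ?x ?z)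
        = ?X \<omega> * (2 + (road_sum \<omega> ?x ?y + road_sum \<omega> ?x ?z))"
      by (simp add: distrib_left ac_simps flip: one_add_one)
    also have "road_sum \<omega> ?x ?y + road_sum \<omega> ?x ?z = word_sum \<omega> w + 2 * road_sum \<omega> ?y ?z"
      using road_sum_children[OF t ne ab(2,1)] by simp
    finally show "?X \<omega> * (1 + road_sum \<omega> ?x ?y) + ?X \<omega> * (1 + road_sum \<omega> ?x ?z)
        = ?X \<omega> * (2 + word_sum \<omega> w) + 2 * (?X \<omega> * road_sum \<omega> ?y ?z)"
      by (simp add: distrib_left ac_simps)
  qed
  also have "\<dots> = (\<integral>\<^sup>+ \<omega>. ?X \<omega> * (2 + word_sum \<omega> w) \<partial>P) + 2 * (\<integral>\<^sup>+ \<omega>. ?X \<omega> * road_sum \<omega> ?y ?z \<partial>P)"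
    by (subst nn_integral_add) (auto simp: nn_integral_cmult)
  also have "\<dots> \<le> (\<integral>\<^sup>+ \<omega>. ?X \<omega> * (2 + word_sum \<omega> w) \<partial>P) + (\<integral>\<^sup>+ \<omega>. ?X \<omega> \<partial>P)"
    by (intro add_left_mono cross)
  also have "\<dots> = (\<integral>\<^sup>+ \<omega>. ?X \<omega> * (2 + word_sum \<omega> w) + ?X \<omega> \<partial>P)"
    by (rule nn_integral_add[symmetric]) auto
  finally have "(\<Sum>a\<in>other_letters w. \<integral>\<^sup>+ \<omega>. path_weight \<omega> (w @ [a]) * (1 + word_sum \<omega> (w @ [a])) \<partial>P)
      + ennreal (1/2) * (\<integral>\<^sup>+ \<omega>. path_weight \<omega> w \<partial>P)
    \<le> (\<integral>\<^sup>+ \<omega>. ?X \<omega> * (2 + word_sum \<omega> w) + ?X \<omega> \<partial>P) + (\<integral>\<^sup>+ \<omega>. ennreal (1/2) * path_weight \<omega> w \<partial>P)"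
    by (simp add: nn_integral_cmult add_right_mono)
  also have "\<dots> = (\<integral>\<^sup>+ \<omega>. ?X \<omega> * (2 + word_sum \<omega> w) + ?X \<omega> + ennreal (1/2) * path_weight \<omega> w \<partial>P)"
    by (rule nn_integral_add[symmetric]) auto
  also have "\<dots> \<le> (\<integral>\<^sup>+ \<omega>. path_weight \<omega> w * (1 + word_sum \<omega> w) \<partial>P)"
  proof (rule nn_integral_mono)
    fix \<omega>
    have "(2 + word_sum \<omega> w) + 1 = 3 + word_sum \<omega> w"
      by (metis add.assoc add.commute numeral_plus_one semiring_norm(5))
    then have "?X \<omega> * (2 + word_sum \<omega> w) + ?X \<omega> + ennreal (1/2) * path_weight \<omega> w
        = path_weight \<omega> w * (word_weight \<omega> w * (3 + word_sum \<omega> w) + ennreal (1/2))"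
      by (simp only: distrib_left mult_1 mult_1_right mult.assoc mult.commute mult.left_commute add.assoc flip: \<open>2 + word_sum \<omega> w + 1 = 3 + word_sum \<omega> w\<close>)
    also have "\<dots> \<le> path_weight \<omega> w * (1 + word_sum \<omega> w)"
      by (intro mult_left_mono edge_weight_drift) auto
    finally show "?X \<omega> * (2 + word_sum \<omega> w) + ?X \<omega> + ennreal (1/2) * path_weight \<omega> w
        \<le> path_weight \<omega> w * (1 + word_sum \<omega> w)" .
  qed
  finally show ?thesis .
qed

section \<open>Summable weights and divergence along rays\<close>

fun subtree_weight :: "'w \<Rightarrow> nat \<Rightarrow> nat list \<Rightarrow> ennreal" where
  "subtree_weight \<omega> 0 w = 0"
| "subtree_weight \<omega> (Suc m) w = path_weight \<omega> w + (\<Sum>a\<in>other_letters w. subtree_weight \<omega> m (w @ [a]))"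

lemma finite_other_letters [simp]: "finite (other_letters w)"
  by (rule finite_subset[of _ "{..<3}"]) (auto simp: other_letters_def)

lemma subtree_weight_measurable:
  "tword w \<Longrightarrow> (\<lambda>\<omega>. subtree_weight \<omega> m w) \<in> borel_measurable P"
proof (induction m arbitrary: w)
  case (Suc m)
  have "tword (w @ [a])" if "a \<in> other_letters w" for a
    using that Suc.prems by (simp add: tword_snoc_iff)
  then show ?case
    using Suc by (auto intro!: borel_measurable_add borel_measurable_sum path_weight_borel)
qed simp

text \<open>Telescopes \<open>drift_step\<close> over the generations. Each vertex uses up half of
  its expected path weight, hence the factor 2, and the bound is uniform in the depth
  \<open>m\<close>.\<close>

lemma nn_integral_subtree_weight:
  assumes "tword w" "w \<noteq> []"
  shows "(\<integral>\<^sup>+ \<omega>. subtree_weight \<omega> m w \<partial>P) \<le> 2 * (\<integral>\<^sup>+ \<omega>. path_weight \<omega> w * (1 + word_sum \<omega> w) \<partial>P)"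
  using assms
proof (induction m arbitrary: w)
  case (Suc m)
  let ?M = "\<lambda>w. \<integral>\<^sup>+ \<omega>. path_weight \<omega> w * (1 + word_sum \<omega> w) \<partial>P"
  have tw: "tword (w @ [a])" if "a \<in> other_letters w" for a
    using that Suc.prems by (simp add: tword_snoc_iff)
  have "(\<integral>\<^sup>+ \<omega>. subtree_weight \<omega> (Suc m) w \<partial>P) =
      (\<integral>\<^sup>+ \<omega>. path_weight \<omega> w \<partial>P) + (\<Sum>a\<in>other_letters w. \<integral>\<^sup>+ \<omega>. subtree_weight \<omega> m (w @ [a]) \<partial>P)"
  proof -
    have m: "(\<lambda>\<omega>. subtree_weight \<omega> m (w @ [a])) \<in> borel_measurable P" if "a \<in> other_letters w" for a
      using tw[OF that] by (rule subtree_weight_measurable)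
    have "(\<integral>\<^sup>+ \<omega>. subtree_weight \<omega> (Suc m) w \<partial>P) = (\<integral>\<^sup>+ \<omega>. path_weight \<omega> w \<partial>P) +
        (\<integral>\<^sup>+ \<omega>. (\<Sum>a\<in>other_letters w. subtree_weight \<omega> m (w @ [a])) \<partial>P)"
      unfolding subtree_weight.simps
      by (intro nn_integral_add borel_measurable_sum path_weight_borel m Suc.prems)
    moreover have "(\<integral>\<^sup>+ \<omega>. (\<Sum>a\<in>other_letters w. subtree_weight \<omega> m (w @ [a])) \<partial>P) =
        (\<Sum>a\<in>other_letters w. \<integral>\<^sup>+ \<omega>. subtree_weight \<omega> m (w @ [a]) \<partial>P)"
      by (rule nn_integral_sum) (rule m)
    ultimately show ?thesis by simp
  qed
  also have "\<dots> \<le> (\<integral>\<^sup>+ \<omega>. path_weight \<omega> w \<partial>P) + (\<Sum>a\<in>other_letters w. 2 * ?M (w @ [a]))"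
    by (intro add_left_mono sum_mono Suc.IH tw) auto
  also have "\<dots> = 2 * ((\<Sum>a\<in>other_letters w. ?M (w @ [a])) + ennreal (1/2) * (\<integral>\<^sup>+ \<omega>. path_weight \<omega> w \<partial>P))"
  proof -
    have "2 * (ennreal (1/2) * x) = x" for x
      by (metis ennreal_two_times_half mult.assoc mult_1)
    then show ?thesis by (simp add: distrib_left sum_distrib_left add.commute)
  qed
  also have "\<dots> \<le> 2 * ?M w"
    by (intro mult_left_mono drift_step Suc.prems) auto
  finally show ?case .
qed simp

lemma subtree_weight_mono: "subtree_weight \<omega> m w \<le> subtree_weight \<omega> (Suc m) w"
proof (induction m arbitrary: w)
  case (Suc m)
  show ?case
    using Suc by (simp only: subtree_weight.simps) (intro add_left_mono sum_mono)
qed simp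

text \<open>Monotone convergence turns the bounds uniform in \<open>m\<close> into integrability of
  the whole sum. The start is a neighbour of the root because the root has no edge above it.\<close>

lemma AE_subtree_weight_finite:
  assumes "tword [a]"
  shows "AE \<omega> in P. (SUP m. subtree_weight \<omega> m [a]) \<noteq> \<infinity>"
proof -
  have ne: "Abs_tvert [] \<noteq> Abs_tvert [a]" using assms by (simp add: Abs_tvert_eq_iff)
  have d: "tdist (Abs_tvert []) (Abs_tvert [a]) = 1"
    using tdist_append[of "[]" "[a]"] assms by simp
  \<comment> \<open>The endpoints of the first edge are at distance 1, so its lines have measure 1/2
    instead of the 1/4 in \<open>mass_le\<close>.\<close>
  let ?m = "\<Sum>j. ennreal (2 ^ (k0 + j + 4)) * ennreal (1/2 * slab_mass \<beta> (k0 + j))"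
  have "?m = 2 * (\<Sum>j. ennreal (2 ^ (k0 + j + 4)) * ennreal (1/4 * slab_mass \<beta> (k0 + j)))"
  proof -
    have "ennreal (1/2 * slab_mass \<beta> k) = 2 * ennreal (1/4 * slab_mass \<beta> k)" for k
    proof -
      have "2 * ennreal (1/4 * slab_mass \<beta> k) = ennreal 2 * ennreal (1/4 * slab_mass \<beta> k)" by simp
      also have "\<dots> = ennreal (1/2 * slab_mass \<beta> k)"
        using slab_mass_pos[OF beta, of k] by (subst ennreal_mult[symmetric]) auto
      finally show ?thesis by simp
    qed
    then show ?thesis by (simp add: mult.left_commute flip: ennreal_suminf_cmult)
  qed
  also have "\<dots> \<le> 2 * ennreal (1/2)" by (intro mult_left_mono mass_le) auto
  also have "\<dots> = 1" by (rule ennreal_two_times_half)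
  also have "(1::ennreal) < \<infinity>" by simp
  finally have m: "?m < \<infinity>" .
  have "(\<integral>\<^sup>+ \<omega>. path_weight \<omega> [a] * (1 + word_sum \<omega> [a]) \<partial>P) = 1 + (\<integral>\<^sup>+ \<omega>. 1 * word_sum \<omega> [a] \<partial>P)"
    using road_sum_measurable[OF ne]
    by (simp add: path_weight_def nn_integral_add emeasure_space_1)
  also have "\<dots> = 1 + ?m"
    using nn_integral_mult_road_sum[of "\<lambda>_. 1" "{}", OF _ ne] d by (simp add: emeasure_space_1)
  finally have fin: "2 * (\<integral>\<^sup>+ \<omega>. path_weight \<omega> [a] * (1 + word_sum \<omega> [a]) \<partial>P) < \<infinity>"
    using m by (simp add: ennreal_mult_less_top)
  have "(\<integral>\<^sup>+ \<omega>. (SUP m. subtree_weight \<omega> m [a]) \<partial>P) = (SUP m. \<integral>\<^sup>+ \<omega>. subtree_weight \<omega> m [a] \<partial>P)"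
    by (intro nn_integral_monotone_convergence_SUP incseq_SucI le_funI subtree_weight_mono
        subtree_weight_measurable assms)
  also have "\<dots> \<le> 2 * (\<integral>\<^sup>+ \<omega>. path_weight \<omega> [a] * (1 + word_sum \<omega> [a]) \<partial>P)"
    by (intro SUP_least nn_integral_subtree_weight assms) auto
  finally have "(\<integral>\<^sup>+ \<omega>. (SUP m. subtree_weight \<omega> m [a]) \<partial>P) \<noteq> \<infinity>"
    using fin by (auto simp: top_unique)
  then show ?thesis
    using subtree_weight_measurable[OF assms] by (intro nn_integral_noteq_infinite) auto
qed

lemma subtree_weight_ge_path:
  assumes "\<And>i. \<exists>a\<in>other_letters (w i). w (Suc i) = w i @ [a]"
  shows "(\<Sum>i<m. path_weight \<omega> (w (n + i))) \<le> subtree_weight \<omega> m (w n)"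
proof (induction m arbitrary: n)
  case (Suc m)
  obtain a where a: "a \<in> other_letters (w n)" "w (Suc n) = w n @ [a]" using assms by blast
  have "(\<Sum>i<Suc m. path_weight \<omega> (w (n + i))) = path_weight \<omega> (w n) + (\<Sum>i<m. path_weight \<omega> (w (Suc n + i)))"
    by (subst sum.lessThan_Suc_shift) simp
  also have "\<dots> \<le> path_weight \<omega> (w n) + subtree_weight \<omega> m (w n @ [a])"
    using Suc.IH[of "Suc n"] a by (intro add_left_mono) simp
  also have "subtree_weight \<omega> m (w n @ [a]) \<le> (\<Sum>a\<in>other_letters (w n). subtree_weight \<omega> m (w n @ [a]))"
    using a by (intro member_le_sum) auto
  finally show ?case by (simp add: add_left_mono)
qed simp

text \<open>If the times summed to a finite t, every path weight along the ray would be at least exp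
  (-\<theta> t), and infinitely many such terms would make the subtree weight infinite.\<close>

lemma time_infinite:
  assumes \<omega>: "\<omega> \<in> space P" "regular \<omega>" and fin: "\<And>a. tword [a] \<Longrightarrow> (SUP m. subtree_weight \<omega> m [a]) \<noteq> \<infinity>"
    and x: "inf_geodesic_from troot x"
  shows "(\<Sum>n. ennreal (driving_distance (Roads \<omega>) (x n) (x (Suc n)))) = \<infinity>"
proof (rule ccontr)
  define c where "c n = driving_distance (Roads \<omega>) (x n) (x (Suc n))" for n
  assume "(\<Sum>n. ennreal (driving_distance (Roads \<omega>) (x n) (x (Suc n)))) \<noteq> \<infinity>"
  then obtain t where t: "(\<Sum>n. ennreal (c n)) = ennreal t" "t \<ge> 0"
    by (cases "\<Sum>n. ennreal (c n)") (auto simp: c_def)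
  define w where "w n = Rep_tvert (x n)" for n
  have x_eq: "x n = Abs_tvert (w n)" for n by (simp add: w_def Rep_tvert_inverse)
  have len: "length (w n) = n" for n using inf_geodesic_tlen[OF x] by (simp add: w_def)
  have ext: "\<exists>a\<in>other_letters (w i). w (Suc i) = w i @ [a]" for i
  proof -
    obtain a where a: "w (Suc i) = w i @ [a]" using inf_geodesic_Suc[OF x, of i] by (auto simp: w_def)
    then have "tword (w i @ [a])" by (metis w_def tword_Rep)
    then show ?thesis using a by (auto simp: tword_snoc_iff)
  qed
  have bl: "butlast (w (Suc i)) = w i" for i using ext[of i] by auto
  have adj: "tadj (x n) (x (Suc n))" for n by (rule inf_geodesic_tadj[OF x])
  then have neq: "x n \<noteq> x (Suc n)" for n using tadj_irrefl by metis
  have c: "c n = 1 / edge_speed (Roads \<omega>) (x n) (x (Suc n))" for n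
    by (simp add: c_def driving_distance_tadj adj)
  have c_pos: "c n \<ge> 0" for n using edge_weight_ge(1)[OF \<omega> neq, of n] by (simp add: c)
  have ww: "ennreal (exp (- \<theta> * c n)) \<le> word_weight \<omega> (w (Suc n))" for n
    using edge_weight_ge(2)[OF \<omega> neq[of n]] by (simp add: c bl x_eq)
  have c_sum: "(\<Sum>i<n. c i) \<le> t" for n
  proof -
    have "ennreal (\<Sum>i<n. c i) = (\<Sum>i<n. ennreal (c i))" using c_pos by (simp add: sum_ennreal)
    also have "\<dots> \<le> ennreal t" unfolding t(1)[symmetric] by (intro sum_le_suminf summableI) auto
    finally show ?thesis using t(2) by simp
  qed
  \<comment> \<open>The path weight of a word of length \<open>Suc n\<close> has \<open>n\<close>
    factors, the first edge included, so the times run over \<open>i < n\<close>.\<close>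
  have pw: "ennreal (exp (- \<theta> * (\<Sum>i<n. c i))) \<le> path_weight \<omega> (w (Suc n))" for n
  proof (induction n)
    case 0
    then show ?case by (simp add: path_weight_def len)
  next
    case (Suc n)
    obtain a where a: "w (Suc (Suc n)) = w (Suc n) @ [a]" using ext by blast
    have ne: "w (Suc n) \<noteq> []" using len[of "Suc n"] by auto
    have "exp (- \<theta> * (\<Sum>i<Suc n. c i)) = exp (- \<theta> * (\<Sum>i<n. c i)) * exp (- \<theta> * c n)"
      by (simp add: algebra_simps flip: exp_add)
    then have "ennreal (exp (- \<theta> * (\<Sum>i<Suc n. c i))) =
        ennreal (exp (- \<theta> * (\<Sum>i<n. c i))) * ennreal (exp (- \<theta> * c n))"
      by (simp only: ennreal_mult[OF exp_ge_zero exp_ge_zero])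
    also have "\<dots> \<le> path_weight \<omega> (w (Suc n)) * word_weight \<omega> (w (Suc n))"
      by (intro mult_mono Suc.IH ww) auto
    finally show ?case unfolding a path_weight_snoc[OF ne] .
  qed
  define e where "e = exp (- \<theta> * t)"
  have e: "e > 0" by (simp add: e_def)
  have pw_e: "ennreal e \<le> path_weight \<omega> (w (Suc n))" for n
  proof -
    have "e \<le> exp (- \<theta> * (\<Sum>i<n. c i))"
      unfolding e_def using theta(1) c_sum[of n] by (simp add: mult_left_mono)
    then show ?thesis using pw[of n] ennreal_leI order_trans by blast
  qed
  obtain a where a: "w 1 = [a]" using len[of 1] by (cases "w 1") auto
  have ta: "tword [a]" using tword_Rep[of "x 1"] a by (metis w_def)
  obtain s where s: "(SUP m. subtree_weight \<omega> m [a]) = ennreal s" "s \<ge> 0"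
    using fin[OF ta] by (cases "SUP m. subtree_weight \<omega> m [a]") auto
  have "real m * e \<le> s" for m
  proof -
    have "ennreal (real m * e) = (\<Sum>i<m. ennreal e)"
      using e by (simp add: ennreal_mult ennreal_of_nat_eq_real_of_nat)
    also have "\<dots> \<le> (\<Sum>i<m. path_weight \<omega> (w (1 + i)))" using pw_e by (intro sum_mono) simp
    also have "\<dots> \<le> subtree_weight \<omega> m (w 1)" by (rule subtree_weight_ge_path) (rule ext)
    also have "\<dots> \<le> ennreal s" unfolding a s(1)[symmetric] by (rule SUP_upper) simp
    finally show ?thesis using s(2) by simp
  qed
  moreover obtain m where "s < real m * e" using ex_less_of_nat_mult[OF e] by blast
  ultimately show False by (meson not_less)
qed

lemma AE_time_infinite:
  "AE \<omega> in P. \<forall>x. inf_geodesic_from troot x \<longrightarrow>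
     (\<Sum>n. ennreal (driving_distance (Roads \<omega>) (x n) (x (Suc n)))) = \<infinity>"
proof -
  have "AE \<omega> in P. \<forall>a. tword [a] \<longrightarrow> (SUP m. subtree_weight \<omega> m [a]) \<noteq> \<infinity>"
    unfolding AE_all_countable using AE_subtree_weight_finite by (auto intro: AE_impI)
  then show ?thesis
    using AE_regular AE_space
    by eventually_elim (blast intro: time_infinite)
qed

end

section \<open>Choice of the constants for \<beta> > 2\<close>

context tree_roads
begin

lemma slow_case:
  assumes "\<beta> > 2"
  shows "AE \<omega> in P. \<forall>x. inf_geodesic_from troot x \<longrightarrow>
     (\<Sum>n. ennreal (driving_distance (Roads \<omega>) (x n) (x (Suc n)))) = \<infinity>"
proof -
  \<comment> \<open>In slab k the weight 2^k times the mass is of order r^k, and \<beta> > 2 makes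
    this summable.\<close>
  define r where "r = 2 powr (2 - \<beta>)"
  have r: "0 < r" "r < 1" using assms by (auto simp: r_def powr_less_one)
  have r_eq: "2 powr (1 - \<beta>) = r / 2" by (simp add: r_def powr_diff)
  have "(\<lambda>k. 4 / (1 - r) * r ^ k) \<longlonglongrightarrow> 4 / (1 - r) * 0"
    using r by (intro tendsto_mult tendsto_const LIMSEQ_realpow_zero) auto
  then have "\<forall>\<^sub>F k in sequentially. 4 / (1 - r) * r ^ k < 1/2"
    by (rule order_tendstoD) simp
  \<comment> \<open>Brings the geometric tail below the 1/2 of \<open>mass_le\<close>; the 4 is 2^4
    times the line measure 1/4.\<close>
  then obtain k0 where k0: "4 / (1 - r) * r ^ k0 < 1/2"
    by (auto simp: eventually_sequentially)
  \<comment> \<open>The exponent at speed 2^k0 becomes -2, and 3 e^(-2) <= 1/2 because e^2 >=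
    6.\<close>
  define \<theta> :: real where "\<theta> = 2 * 2 ^ k0"
  have "exp (- \<theta> * (1/2) ^ k0) = exp (-2 :: real)"
    by (simp add: \<theta>_def power_one_over)
  moreover have "6 \<le> exp (2::real)"
  proof -
    have "(5/2 :: real) \<le> exp 1" using exp_lower_Taylor_quadratic[of 1] by simp
    then have "(5/2 :: real) * (5/2) \<le> exp 1 * exp 1" by (intro mult_mono) auto
    then show ?thesis by (simp flip: exp_add)
  qed
  ultimately have theta: "3 * exp (- \<theta> * (1/2) ^ k0) \<le> 1/2"
    by (simp add: exp_minus field_simps)
  have term_le: "2 ^ (k0 + j + 4) * (1/4 * slab_mass \<beta> (k0 + j)) \<le> 4 * r ^ k0 * r ^ j" for j
  proof -
    have "2 ^ (k0 + j + 4) * (1/4 * slab_mass \<beta> (k0 + j)) = 4 * (1 - r / 2) * (2 ^ (k0 + j) * (r / 2) ^ (k0 + j))"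
      by (simp add: slab_mass_def r_eq power_add)
    also have "2 ^ (k0 + j) * (r / 2) ^ (k0 + j) = r ^ (k0 + j)"
      by (simp flip: power_mult_distrib)
    also have "4 * (1 - r / 2) * r ^ (k0 + j) \<le> 4 * 1 * r ^ (k0 + j)"
      using r by (intro mult_right_mono mult_left_mono) auto
    finally show ?thesis by (simp add: power_add)
  qed
  have "(\<Sum>j. ennreal (2 ^ (k0 + j + 4)) * ennreal (1/4 * slab_mass \<beta> (k0 + j))) \<le> (\<Sum>j. ennreal (4 * r ^ k0 * r ^ j))"
    using slab_mass_pos[OF beta] term_le
    by (intro suminf_le summableI) (auto simp: less_imp_le simp flip: ennreal_mult intro!: ennreal_leI)
  also have "\<dots> = ennreal (4 * r ^ k0 * (1 / (1 - r)))"
    using r by (intro suminf_ennreal_eq sums_mult geometric_sums) auto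
  also have "\<dots> \<le> ennreal (1/2)"
    using k0 by (intro ennreal_leI) (simp add: ac_simps)
  finally have mass: "(\<Sum>j. ennreal (2 ^ (k0 + j + 4)) * ennreal (1/4 * slab_mass \<beta> (k0 + j))) \<le> ennreal (1/2)" .
  have "1 \<le> (2::real) ^ k0" by (rule one_le_power) simp
  then have "\<theta> \<ge> 1" unfolding \<theta>_def by linarith
  with theta mass interpret slow_tree_roads \<beta> \<mu> P Roads k0 \<theta> by unfold_locales
  show ?thesis by (rule AE_time_infinite)
qed

end

section \<open>Speed exponent below 2\<close>

lemma exists_sibling:
  assumes "tword w" "j < length w"
  shows "\<exists>c. tword (take j w @ [c]) \<and> c \<noteq> w ! j"
proof -
  define a where "a = w ! j"
  \<comment> \<open>The value 3 is no letter and stands for the missing last letter at the root, so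
    that \<open>c\<close> always has to avoid the two values \<open>a\<close> and
    \<open>l\<close>.\<close>
  define l where "l = (if take j w = [] then 3 else last (take j w))"
  define c :: nat where "c = (if a \<noteq> 0 \<and> l \<noteq> 0 then 0 else if a \<noteq> 1 \<and> l \<noteq> 1 then 1 else 2)"
  have "c < 3" "c \<noteq> a" "c \<noteq> l" by (auto simp: c_def)
  then show ?thesis
    using tword_take[OF assms(1), of j] by (intro exI[of _ c]) (auto simp: tword_snoc a_def l_def split: if_splits)
qed

lemma exists_tword: "\<exists>w. tword w \<and> length w = n"
proof (induction n)
  case (Suc n)
  then obtain w where w: "tword w" "length w = n" by auto
  have "\<exists>c<3. w \<noteq> [] \<longrightarrow> c \<noteq> last w"
    by (intro exI[of _ "if last w = 0 then 1 else 0"]) auto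
  then obtain c where "tword (w @ [c])" using w by (auto simp: tword_snoc)
  then show ?case using w by (intro exI[of _ "w @ [c]"]) auto
qed auto

context tree_roads
begin

text \<open>Number of vertices at which the ray of stage \<open>n\<close> looks for a road of stage \<open>n + 1\<close>\<close>

definition stage_length :: "nat \<Rightarrow> nat" where
  "stage_length n = nat \<lceil>4 * real n / slab_mass \<beta> (Suc n)\<rceil> + 1"

text \<open>The lower bound makes the intensity of the exits of stage \<open>n\<close> at least
  \<open>n\<close>, the 4 cancelling the line measure 1/4. The upper bound controls the travel
  time.\<close>

lemma stage_length_bounds:
  "4 * real n / slab_mass \<beta> (Suc n) \<le> stage_length n"
  "stage_length n \<le> 4 * real n / slab_mass \<beta> (Suc n) + 2"
proof -
  define x where "x = 4 * real n / slab_mass \<beta> (Suc n)"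
  have "0 \<le> x" unfolding x_def using slab_mass_pos[OF beta, of "Suc n"] by simp
  then have "real (stage_length n) = of_int \<lceil>x\<rceil> + 1" by (simp add: stage_length_def x_def)
  then show "x \<le> stage_length n" "stage_length n \<le> x + 2" by linarith+
qed

text \<open>An edge of stage \<open>n\<close> costs at most 2^(-n), and the number of edges is of
  order n 2^(n(\<beta>-1)). The product is n x^n with x = 2^(\<beta>-2) < 1, up to constants and a
  geometric term.\<close>

lemma summable_stage_time:
  assumes "\<beta> < 2"
  shows "summable (\<lambda>n. real (stage_length n) / 2 ^ n)"
proof -
  define r where "r = 2 powr (1 - \<beta>)"
  define x where "x = 2 powr (\<beta> - 2)"
  have r: "0 < r" "r < 1" using beta by (auto simp: r_def powr_less_one)
  have x: "0 < x" "x < 1" using assms by (auto simp: x_def powr_less_one)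
  have "2 * r * x = 1"
  proof -
    have "r * x = 2 powr (-1)" by (simp add: r_def x_def flip: powr_add)
    then show ?thesis by (simp add: powr_minus)
  qed
  define D where "D = 4 / ((1 - r) * r)"
  have D: "D \<ge> 0" using r by (simp add: D_def)
  have bound: "real (stage_length n) / 2 ^ n \<le> D * (real (Suc n) * x ^ n) + 2 * (1/2) ^ n" for n
  proof -
    have "2 ^ n * r ^ n * x ^ n = 1" using \<open>2 * r * x = 1\<close> by (metis power_mult_distrib power_one)
    moreover have "2 ^ n * r ^ n \<noteq> 0" using r by simp
    ultimately have e: "1 / (2 ^ n * r ^ n) = x ^ n" by (metis nonzero_mult_div_cancel_left)
    have split: "(4 * k / (a * (r * t)) + 2) / u = 4 / (a * r) * k * (1 / (u * t)) + 2 * (1 / u)"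
      if "a \<noteq> 0" "u \<noteq> 0" "t \<noteq> 0" for a k t u :: real
      using that r by (simp add: add_divide_distrib)
    have "real (stage_length n) / 2 ^ n \<le> (4 * real n / slab_mass \<beta> (Suc n) + 2) / 2 ^ n"
      using stage_length_bounds(2) by (intro divide_right_mono) auto
    also have "\<dots> = D * real n * (1 / (2 ^ n * r ^ n)) + 2 * (1/2) ^ n"
      unfolding slab_mass_def r_def[symmetric] D_def power_Suc power_one_over using r by (intro split) auto
    also have "\<dots> = D * real n * x ^ n + 2 * (1/2) ^ n" unfolding e ..
    also have "\<dots> \<le> D * (real (Suc n) * x ^ n) + 2 * (1/2) ^ n"
      using D x by (simp add: algebra_simps)
    finally show ?thesis .
  qed
  \<comment> \<open>With \<open>Suc n\<close> in place of \<open>n\<close>, the first part is the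
    derivative of the geometric series.\<close>
  have "summable (\<lambda>n. D * (real (Suc n) * x ^ n) + 2 * (1/2) ^ n)"
    using geometric_deriv_sums[of x] x
    by (intro summable_add summable_mult summable_geometric) (auto dest: sums_summable)
  then show ?thesis
    by (rule summable_comparison_test') (use bound in auto)
qed

text \<open>A state \<open>(w, m)\<close> of stage \<open>n\<close> stands for the path from the root to \<open>w\<close>, whose part below
  depth \<open>m - 1\<close> is covered by a road with speed in \<open>slab n\<close>.\<close>

definition valid :: "nat \<Rightarrow> nat list \<times> nat \<Rightarrow> bool" where
  "valid n s \<longleftrightarrow> tword (fst s) \<and> length (fst s) = snd s + stage_length n"

text \<open>Serves as the initial state and as a filler when no successor exists, so that every
  state is valid. No road is claimed to cover it.\<close>

definition default_state :: "nat \<Rightarrow> nat list \<times> nat" where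
  "default_state n = (SOME s. valid n s \<and> snd s = 0)"

lemma default_state: "valid n (default_state n)" "snd (default_state n) = 0"
proof -
  obtain w where "tword w" "length w = stage_length n" using exists_tword by blast
  then have "\<exists>s. valid n s \<and> snd s = 0" by (intro exI[of _ "(w, 0)"]) (simp add: valid_def)
  from someI_ex[OF this] show "valid n (default_state n)" "snd (default_state n) = 0"
    by (auto simp: default_state_def)
qed

section \<open>Roads branching off the current path\<close>

definition sibling :: "nat list \<Rightarrow> nat \<Rightarrow> nat list" where
  "sibling w j = take j w @ [SOME c. tword (take j w @ [c]) \<and> c \<noteq> w ! j]"

lemma sibling:
  assumes "tword w" "j < length w"
  obtains c where "sibling w j = take j w @ [c]" "tword (take j w @ [c])" "c \<noteq> w ! j"
  using someI_ex[OF exists_sibling[OF assms]] that by (auto simp: sibling_def)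

text \<open>These lines turn at \<open>take j w\<close>, between the path and a child off the path,
  and have measure 1/4. Turning there makes the sets for different \<open>j\<close>
  disjoint.\<close>

definition branch_lines :: "nat list \<Rightarrow> nat \<Rightarrow> tvert set set" where
  "branch_lines w j = line_through (Abs_tvert (take (Suc j) w)) (Abs_tvert (sibling w j))"

lemma take_Suc_snoc: "j < length w \<Longrightarrow> take (Suc j) w = take j w @ [w ! j]"
  by (rule take_Suc_conv_app_nth)

lemma branch_lines_apex:
  assumes w: "tword w" "j < length w" and L: "L \<in> branch_lines w j"
  shows "Abs_tvert (take j w) \<in> L" "i < j \<Longrightarrow> Abs_tvert (take i w) \<notin> L"
proof -
  obtain c where c: "sibling w j = take j w @ [c]" "tword (take j w @ [c])" "c \<noteq> w ! j"
    using sibling[OF w] .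
  have t: "tword (take j w @ [w ! j])" using w tword_take[of w "Suc j"] by (simp add: take_Suc_snoc)
  have L': "L \<in> tlines" "Abs_tvert (take j w @ [w ! j]) \<in> L" "Abs_tvert (take j w @ [c]) \<in> L"
    using L w by (auto simp: branch_lines_def line_through_def take_Suc_snoc c)
  show "Abs_tvert (take j w) \<in> L"
    using line_through_siblings_apex[OF L'(1) t c(2) _ L'(2,3)] c(3) by auto
  show "Abs_tvert (take i w) \<notin> L" if "i < j"
    using line_through_siblings_above[OF L'(1) t c(2) _ L'(2,3), of i] c(3) that w by (auto simp: min_def)
qed

lemma branch_slab:
  assumes w: "tword w" "j < length w"
  shows "branch_lines w j \<times> slab k \<in> sets \<nu>"
    and "emeasure \<nu> (branch_lines w j \<times> slab k) = ennreal (1/4 * slab_mass \<beta> k)"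
proof -
  obtain c where c: "sibling w j = take j w @ [c]" "tword (take j w @ [c])" "c \<noteq> w ! j"
    using sibling[OF w] .
  have t: "tword (take j w @ [w ! j])" using w tword_take[of w "Suc j"] by (simp add: take_Suc_snoc)
  have d: "tdist (Abs_tvert (take (Suc j) w)) (Abs_tvert (sibling w j)) = 2"
    using tdist_siblings[OF t c(2)] c w by (simp add: take_Suc_snoc)
  then have ne: "Abs_tvert (take (Suc j) w) \<noteq> Abs_tvert (sibling w j)" by auto
  show "branch_lines w j \<times> slab k \<in> sets \<nu>"
    unfolding branch_lines_def using ne by (rule road_slab_sets)
  show "emeasure \<nu> (branch_lines w j \<times> slab k) = ennreal (1/4 * slab_mass \<beta> k)"
    unfolding branch_lines_def emeasure_road_slab[OF ne] d by (simp add: power2_eq_square)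
qed

text \<open>Invalid states get the empty set, so that \<open>exits n s\<close> is measurable for
  every state, as \<open>prob_random_void_le\<close> requires.\<close>

definition exits :: "nat \<Rightarrow> nat list \<times> nat \<Rightarrow> (tvert set \<times> real) set" where
  "exits n s = (if valid n s
     then \<Union>j\<in>{snd s..<snd s + stage_length n}. branch_lines (fst s) j \<times> slab (Suc n) else {})"

lemma exits_sets: "exits n s \<in> sets \<nu>"
  using branch_slab(1) by (auto simp: exits_def valid_def intro!: sets.finite_UN)

lemma exits_slab: "exits n s \<subseteq> UNIV \<times> slab (Suc n)"
  by (auto simp: exits_def)

text \<open>The intensities of the disjoint branch sets add up to \<open>stage_length n\<close>
  times a quarter of the slab mass, which is at least \<open>n\<close>.\<close>

lemma prob_void_exits:
  assumes v: "valid n s"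
  shows "prob (void (exits n s)) \<le> exp (- real n)"
proof -
  obtain w m where s: "s = (w, m)" by force
  have w: "tword w" "length w = m + stage_length n" using v by (auto simp: valid_def s)
  let ?B = "\<lambda>j. branch_lines w j \<times> slab (Suc n)"
  let ?c = "slab_mass \<beta> (Suc n)"
  have c: "?c > 0" by (rule slab_mass_pos[OF beta])
  \<comment> \<open>For i < j, a line turning at depth i contains \<open>take i w\<close>, whereas a
    line turning at depth j meets no vertex of the path above depth j.\<close>
  have disj: "disjoint_family_on ?B {m..<m + stage_length n}"
  proof -
    have "branch_lines w i \<inter> branch_lines w j = {}" if "i < j" "j < length w" for i j
      using branch_lines_apex(1)[OF w(1), of i] branch_lines_apex(2)[OF w(1) that(2) _ that(1)] that by force
    then show ?thesis
      unfolding disjoint_family_on_def using w(2)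
      by (metis (no_types, lifting) Sigma_Int_distrib1 atLeastLessThan_iff inf_commute linorder_neqE_nat Sigma_empty1)
  qed
  have "emeasure \<nu> (exits n s) = (\<Sum>j\<in>{m..<m + stage_length n}. emeasure \<nu> (?B j))"
  proof -
    have "exits n s = (\<Union>j\<in>{m..<m + stage_length n}. ?B j)" using v by (simp add: exits_def s)
    then show ?thesis
      using branch_slab(1) w disj by (simp add: sum_emeasure[symmetric] image_subset_iff)
  qed
  also have "\<dots> = (\<Sum>j\<in>{m..<m + stage_length n}. ennreal (1/4 * ?c))"
    using branch_slab(2) w by (intro sum.cong) auto
  also have "\<dots> = ennreal (real (stage_length n) * (1/4 * ?c))"
    unfolding sum_constant card_atLeastLessThan add_diff_cancel_left' ennreal_of_nat_eq_real_of_nat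
    using c by (intro ennreal_mult[symmetric]) auto
  finally have e: "emeasure \<nu> (exits n s) = ennreal (real (stage_length n) * (1/4 * ?c))" .
  have "prob (void (exits n s)) = exp (- (real (stage_length n) * (1/4 * ?c)))"
    using prob_void[OF exits_sets, of n s] e c by simp
  also have "real n \<le> real (stage_length n) * (1/4 * ?c)"
    using stage_length_bounds(1)[of n] c by (simp add: field_simps)
  then have "exp (- (real (stage_length n) * (1/4 * ?c))) \<le> exp (- real n)" by simp
  finally show ?thesis .
qed

section \<open>The exploration from stage to stage\<close>

definition state_lines :: "nat list \<times> nat \<Rightarrow> tvert set set" where
  "state_lines s = line_through (Abs_tvert (take (snd s - 1) (fst s))) (Abs_tvert (fst s))"

text \<open>The branching vertex has depth \<open>snd s' - 1\<close>: the old path is kept down to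
  it, and by \<open>successor\<close> the edge below it is already on the new road.\<close>

definition extends :: "nat \<Rightarrow> nat list \<times> nat \<Rightarrow> nat list \<times> nat \<Rightarrow> bool" where
  "extends n s s' \<longleftrightarrow> valid (Suc n) s' \<and> snd s < snd s' \<and> snd s' \<le> snd s + stage_length n \<and>
     take (snd s' - 1) (fst s') = take (snd s' - 1) (fst s)"

definition successor :: "'w \<Rightarrow> nat \<Rightarrow> nat list \<times> nat \<Rightarrow> nat list \<times> nat \<Rightarrow> bool" where
  "successor \<omega> n s s' \<longleftrightarrow> extends n s s' \<and> Roads \<omega> \<inter> (state_lines s' \<times> slab (Suc n)) \<noteq> {}"

text \<open>A road in \<open>exits n s\<close> turns at a vertex of the path. Following it to the
  sibling and then down for \<open>stage_length (Suc n)\<close> further steps yields the new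
  path.\<close>

lemma exists_successor:
  assumes \<omega>: "\<omega> \<in> space P" and v: "valid n s" and ex: "Roads \<omega> \<inter> exits n s \<noteq> {}"
  shows "\<exists>s'. successor \<omega> n s s'"
proof -
  obtain w m where s: "s = (w, m)" by force
  have w: "tword w" "length w = m + stage_length n" using v by (auto simp: valid_def s)
  obtain j L u where j: "m \<le> j" "j < m + stage_length n" and L: "L \<in> branch_lines w j"
    and u: "u \<in> slab (Suc n)" "(L, u) \<in> Roads \<omega>"
    using ex v by (auto simp: exits_def s)
  have jw: "j < length w" using j w by simp
  obtain c where c: "sibling w j = take j w @ [c]" "tword (take j w @ [c])" "c \<noteq> w ! j"
    using sibling[OF w(1) jw] .
  have L': "L \<in> tlines" "Abs_tvert (take j w @ [c]) \<in> L"
    using L by (auto simp: branch_lines_def line_through_def c)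
  have apex: "Abs_tvert (take j w) \<in> L" by (rule branch_lines_apex(1)[OF w(1) jw L])
  obtain v where v: "length v = stage_length (Suc n)" "tword (take j w @ c # v)" "Abs_tvert (take j w @ c # v) \<in> L"
    using line_through_descend[OF L'(1) c(2) apex L'(2)] by blast
  let ?s = "(take j w @ c # v, Suc j)"
  have "successor \<omega> n s ?s"
    using j jw v L' apex u
    by (auto simp: successor_def extends_def valid_def s state_lines_def line_through_def)
  then show ?thesis ..
qed

text \<open>Taking the successor with the least code, instead of an arbitrary one, keeps the state a
  measurable function of the roads.\<close>

fun state :: "nat \<Rightarrow> 'w \<Rightarrow> nat \<Rightarrow> nat list \<times> nat" where
  "state K \<omega> 0 = default_state K"
| "state K \<omega> (Suc i) = (if \<exists>k. successor \<omega> (K + i) (state K \<omega> i) (from_nat k)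
     then from_nat (LEAST k. successor \<omega> (K + i) (state K \<omega> i) (from_nat k)) else default_state (K + Suc i))"

lemma successor_state:
  assumes "\<exists>s'. successor \<omega> (K + i) (state K \<omega> i) s'"
  shows "successor \<omega> (K + i) (state K \<omega> i) (state K \<omega> (Suc i))"
proof -
  from assms have "\<exists>k. successor \<omega> (K + i) (state K \<omega> i) (from_nat k)" by (metis from_nat_to_nat)
  then show ?thesis using LeastI_ex[of "\<lambda>k. successor \<omega> (K + i) (state K \<omega> i) (from_nat k)"] by simp
qed

lemma valid_state: "valid (K + i) (state K \<omega> i)"
proof (induction i)
  case (Suc i)
  show ?case
  proof (cases "\<exists>s'. successor \<omega> (K + i) (state K \<omega> i) s'")
    case True
    then show ?thesis using successor_state by (auto simp: successor_def extends_def simp del: state.simps)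
  next
    case False
    then have "\<not> (\<exists>k. successor \<omega> (K + i) (state K \<omega> i) (from_nat k))" by blast
    then have "state K \<omega> (Suc i) = default_state (K + Suc i)" by (simp only: state.simps if_False)
    then show ?thesis using default_state(1) by simp
  qed
qed (simp add: default_state)

lemma successor_measurable:
  assumes R: "UNIV \<times> slab (Suc n) \<subseteq> R"
  shows "Measurable.pred (void_algebra R) (\<lambda>\<omega>. successor \<omega> n s s')"
proof (cases "extends n s s'")
  case True
  obtain w m where s': "s' = (w, m)" by force
  have w: "tword w" "length w = m + stage_length (Suc n)" "m > 0"
    using True by (auto simp: extends_def valid_def s')
  have "take (m - 1) w \<noteq> w" using w by (auto dest: arg_cong[of _ _ length])
  then have "Abs_tvert (take (m - 1) w) \<noteq> Abs_tvert w" using w by (simp add: Abs_tvert_eq_iff tword_take)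
  then have "state_lines s' \<times> slab (Suc n) \<in> sets \<nu>"
    unfolding state_lines_def s' by (intro road_slab_sets) simp
  then have "Measurable.pred (void_algebra R) (\<lambda>\<omega>. Roads \<omega> \<inter> (state_lines s' \<times> slab (Suc n)) \<noteq> {})"
    using R by (intro pred_road_exists) auto
  then show ?thesis using True by (simp add: successor_def)
qed (simp add: successor_def)

lemma slab_subset: "k \<le> n \<Longrightarrow> slab k \<subseteq> {..2 ^ Suc n}"
  unfolding slab_def by (force intro: order_trans[OF _ power_increasing[of "Suc k" "Suc n" "2::real"]] simp del: power_Suc)

text \<open>The first \<open>i\<close> searches inspect slabs up to \<open>K + i\<close>, with
  speeds at most 2^(K+i+1). Each step is measurable for a fixed previous state, and there are only
  countably many states.\<close>

lemma state_measurable: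
  "(\<lambda>\<omega>. state K \<omega> i) \<in> measurable (void_algebra (UNIV \<times> {..2 ^ Suc (K + i)})) (count_space UNIV)"
proof (induction i)
  case (Suc i)
  let ?R = "UNIV \<times> {..2 ^ Suc (K + Suc i)} :: (tvert set \<times> real) set"
  have st: "(\<lambda>\<omega>. state K \<omega> i) \<in> measurable (void_algebra ?R) (count_space UNIV)"
    by (intro measurable_void_algebra_mono[OF Suc] Sigma_mono order_refl)
      (force intro: order_trans[OF _ power_increasing[of "Suc (K + i)" "Suc (K + Suc i)" "2::real"]] simp del: power_Suc)
  have [measurable]: "Measurable.pred (void_algebra ?R) (\<lambda>\<omega>. successor \<omega> (K + i) s s')" for s s'
    using slab_subset[of "Suc (K + i)" "K + Suc i"] by (intro successor_measurable) auto
  have "(\<lambda>\<omega>. if \<exists>k. successor \<omega> (K + i) s (from_nat k)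
       then from_nat (LEAST k. successor \<omega> (K + i) s (from_nat k)) else default_state (K + Suc i))
     \<in> measurable (void_algebra ?R) (count_space UNIV)" for s
    by measurable
  from measurable_compose_countable[OF this st] show ?case by simp
qed simp

definition stuck :: "nat \<Rightarrow> nat \<Rightarrow> 'w set" where
  "stuck K i = {\<omega> \<in> space P. Roads \<omega> \<inter> exits (K + i) (state K \<omega> i) = {}}"

text \<open>The state depends on speeds at most 2^(K+i+1), while its exits have larger speeds. So
  the search is independent of the state that determines where to search.\<close>

lemma stuck: "stuck K i \<in> events" "prob (stuck K i) \<le> exp (- real (K + i))"
proof -
  have disj: "exits (K + i) s \<inter> (UNIV \<times> {..2 ^ Suc (K + i)}) = {}" for s
    using exits_slab[of "K + i" s] slab_disjoint[of "K + i" "Suc (K + i)"] by blast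
  have le: "prob (void (exits (K + i) s)) \<le> exp (- real (K + i))" if s: "s \<in> (\<lambda>\<omega>. state K \<omega> i) ` space P" for s
  proof -
    obtain \<omega> where "s = state K \<omega> i" using s by blast
    then show ?thesis using prob_void_exits[OF valid_state] by blast
  qed
  show "stuck K i \<in> events" "prob (stuck K i) \<le> exp (- real (K + i))"
    unfolding stuck_def using prob_random_void_le[OF state_measurable exits_sets disj le] by auto
qed

text \<open>For fixed K the failure probabilities e^(-(K+i)) sum over i to a multiple of e^(-K).
  Letting K grow, the event that every starting stage fails has probability 0.\<close>

lemma AE_not_stuck: "AE \<omega> in P. \<exists>K. \<forall>i. \<omega> \<notin> stuck K i"
proof -
  define q where "q = exp (-1 :: real)"
  have q: "0 < q" "q < 1" by (auto simp: q_def)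
  have q_pow: "exp (- real n) = q ^ n" for n by (simp add: q_def flip: exp_of_nat_mult)
  define F where "F K = (\<Union>i. stuck K i)" for K
  have F: "F K \<in> events" for K unfolding F_def using stuck(1) by auto
  have "prob (F K) \<le> q ^ K * (1 / (1 - q))" for K
  proof -
    have sums: "(\<lambda>i. q ^ K * q ^ i) sums (q ^ K * (1 / (1 - q)))"
      using q by (intro sums_mult geometric_sums) auto
    have le: "prob (stuck K i) \<le> q ^ K * q ^ i" for i
      using stuck(2)[of K i] by (simp only: q_pow power_add)
    have summ: "summable (\<lambda>i. prob (stuck K i))"
      by (rule summable_comparison_test'[OF sums_summable[OF sums]]) (use le in auto)
    have "prob (F K) \<le> (\<Sum>i. prob (stuck K i))"
      unfolding F_def using stuck(1) summ by (intro finite_measure_subadditive_countably) auto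
    also have "\<dots> \<le> (\<Sum>i. q ^ K * q ^ i)" by (rule suminf_le[OF le summ sums_summable[OF sums]])
    also have "\<dots> = q ^ K * (1 / (1 - q))" using sums by (rule sums_unique[symmetric])
    finally show ?thesis .
  qed
  then have le: "prob (\<Inter>K. F K) \<le> q ^ K * (1 / (1 - q))" for K
    using finite_measure_mono[of "\<Inter>K. F K" "F K"] F by (meson INT_lower UNIV_I order_trans)
  have "(\<lambda>K. q ^ K * (1 / (1 - q))) \<longlonglongrightarrow> 0 * (1 / (1 - q))"
    using q by (intro tendsto_mult LIMSEQ_realpow_zero tendsto_const) auto
  then have "prob (\<Inter>K. F K) \<le> 0"
    using le by (intro LIMSEQ_le_const[of _ 0]) auto
  then have "emeasure P (\<Inter>K. F K) = 0"
    by (simp add: emeasure_eq_measure measure_le_0_iff)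
  then have "(\<Inter>K. F K) \<in> null_sets P" using F by (intro null_setsI) auto
  from AE_not_in[OF this] show ?thesis by (auto simp: F_def)
qed

section \<open>Travel time of the limiting ray\<close>

lemma edge_time_le:
  assumes \<omega>: "\<omega> \<in> space P" "regular \<omega>" and v: "valid n s" and road: "Roads \<omega> \<inter> (state_lines s \<times> slab n) \<noteq> {}"
    and k: "snd s - 1 \<le> k" "k < length (fst s)"
  shows "1 / edge_speed (Roads \<omega>) (Abs_tvert (take k (fst s))) (Abs_tvert (take (Suc k) (fst s))) \<le> 1 / 2 ^ n"
proof -
  obtain w m where s: "s = (w, m)" by force
  have w: "tword w" using v by (simp add: valid_def s)
  obtain L u where L: "(L, u) \<in> Roads \<omega>" "u \<in> slab n" "L \<in> tlines"
    "Abs_tvert (take (m - 1) w) \<in> L" "Abs_tvert w \<in> L"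
    using road by (auto simp: s state_lines_def line_through_def)
  have in_L: "Abs_tvert (take i w) \<in> L" if "m - 1 \<le> i" for i
  proof -
    have "take (m - 1) w @ take (i - (m - 1)) (drop (m - 1) w) = take i w"
      using that by (metis le_add_diff_inverse take_add)
    then show ?thesis
      using line_through_prefix_in[OF L(3), of "take (m - 1) w" "drop (m - 1) w" "i - (m - 1)"] w L by simp
  qed
  let ?x = "Abs_tvert (take k w)" and ?y = "Abs_tvert (take (Suc k) w)"
  have "take k w \<noteq> take (Suc k) w" using k by (auto simp: s dest: arg_cong[of _ _ length])
  then have ne: "?x \<noteq> ?y" using w by (simp add: Abs_tvert_eq_iff tword_take)
  have "u \<in> edge_speeds \<omega> ?x ?y"
    using L in_L[of k] in_L[of "Suc k"] k by (auto simp: edge_speeds_def s)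
  then have "u \<le> edge_speed (Roads \<omega>) ?x ?y"
    unfolding edge_speed_eq using \<omega>(2) ne by (intro cSup_upper) (auto simp: regular_def)
  moreover have "2 ^ n < u" using L by (simp add: slab_def)
  ultimately show ?thesis unfolding s fst_conv by (intro divide_left_mono mult_pos_pos) (auto intro: less_le_trans[of 0 "2 ^ n"])
qed

text \<open>\<open>w i\<close> and all later paths agree down to depth \<open>m i\<close>, so the
  paths converge to a ray. For i >= 1 its edges from depth \<open>m i\<close> to
  \<open>m (Suc i)\<close> number at most \<open>stage_length (K + i)\<close> and take time at most
  2^(-i) each.\<close>

lemma exists_fast_path:
  assumes \<beta>: "\<beta> < 2" and \<omega>: "\<omega> \<in> space P" "regular \<omega>" and K: "\<And>i. \<omega> \<notin> stuck K i"
  shows "\<exists>x. inf_geodesic_from troot x \<and>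
    (\<Sum>n. ennreal (driving_distance (Roads \<omega>) (x n) (x (Suc n)))) < \<infinity>"
proof -
  define w where "w i = fst (state K \<omega> i)" for i
  define m where "m i = snd (state K \<omega> i)" for i
  have valid: "tword (w i)" "length (w i) = m i + stage_length (K + i)" for i
    using valid_state[of K i \<omega>] by (auto simp: w_def m_def valid_def)
  have succ: "successor \<omega> (K + i) (state K \<omega> i) (state K \<omega> (Suc i))" for i
    using K[of i] \<omega>(1) by (intro successor_state exists_successor valid_state) (auto simp: stuck_def)
  then have m_less: "m i < m (Suc i)" and m_le: "m (Suc i) \<le> m i + stage_length (K + i)"
    and w_take: "take (m (Suc i) - 1) (w (Suc i)) = take (m (Suc i) - 1) (w i)" for i
    by (auto simp: successor_def extends_def w_def m_def simp del: state.simps)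
  have m_mono: "m i \<le> m j" if "i \<le> j" for i j
    using that
  proof (induction j rule: dec_induct)
    case (step j) then show ?case using m_less[of j] by linarith
  qed simp
  have m_ge: "i \<le> m i" for i
  proof (induction i)
    case (Suc i) then show ?case using m_less[of i] by simp
  qed simp
  have consist: "take k (w j) = take k (w i)" if "i \<le> j" "k \<le> m i" for i j k
    using that(1)
  proof (induction j rule: dec_induct)
    case (step j)
    have "k \<le> m (Suc j) - 1" using m_less[of j] m_mono[of i j] step that(2) by simp
    then have "take k (w (Suc j)) = take k (w j)" using w_take[of j] by (metis min.absorb1 take_take)
    then show ?case using step by simp
  qed simp
  \<comment> \<open>Depth \<open>k\<close> no longer changes after stage \<open>k\<close>, because
    \<open>k\<close> is at most \<open>m k\<close>.\<close>
  define p where "p k = take k (w k)" for k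
  have p_eq: "p k = take k (w i)" if "k \<le> m i" for i k
    using consist[of i k k] consist[of k i k] that m_ge[of k] by (cases "i \<le> k") (auto simp: p_def)
  have p: "tword (p k)" "length (p k) = k" for k
    using valid[of k] m_ge[of k] by (auto simp: p_def tword_take)
  have bl: "butlast (p (Suc k)) = p k" for k
  proof -
    have "p k = take k (w (Suc k))" using m_ge[of "Suc k"] by (intro p_eq) simp
    then show ?thesis using valid(2)[of "Suc k"] m_ge[of "Suc k"] by (simp add: p_def butlast_take)
  qed
  have geo: "inf_geodesic_from troot (\<lambda>n. Abs_tvert (p n))"
    by (rule inf_geodesicI[OF p bl])
  define c where "c k = driving_distance (Roads \<omega>) (Abs_tvert (p k)) (Abs_tvert (p (Suc k)))" for k
  have c: "c k = 1 / edge_speed (Roads \<omega>) (Abs_tvert (p k)) (Abs_tvert (p (Suc k)))" for k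
    unfolding c_def using inf_geodesic_tadj[OF geo, of k] by (rule driving_distance_tadj)
  \<comment> \<open>Stage 0 is excluded because its default path is not known to be covered by a
    road.\<close>
  have c_le: "c k \<le> 1 / 2 ^ i" if i: "i \<ge> 1" and k: "m i \<le> k" "k < m (Suc i)" for i k
  proof -
    have road: "Roads \<omega> \<inter> (state_lines (state K \<omega> i) \<times> slab (K + i)) \<noteq> {}" if "i \<ge> 1" for i
      using succ[of "i - 1"] that by (auto simp: successor_def simp del: state.simps)
    have time: "1 / edge_speed (Roads \<omega>) (Abs_tvert (take k (w i))) (Abs_tvert (take (Suc k) (w i))) \<le> 1 / 2 ^ (K + i)"
      if "i \<ge> 1" "m i - 1 \<le> k" "k < length (w i)" for i
      unfolding w_def using that
      by (intro edge_time_le[OF \<omega> valid_state road]) (auto simp: w_def m_def)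
    have pow: "1 / (2::real) ^ (K + i) \<le> 1 / 2 ^ i" "1 / (2::real) ^ (K + Suc i) \<le> 1 / 2 ^ i"
      by (intro divide_left_mono power_increasing; simp)+
    show ?thesis
    proof (cases "Suc k = m (Suc i)")
      \<comment> \<open>The last edge before depth \<open>m (Suc i)\<close> leaves the branching
        vertex and is already on the road of the next stage.\<close>
      case True
      have "p k = take k (w (Suc i))" "p (Suc k) = take (Suc k) (w (Suc i))" using k by (auto intro!: p_eq)
      then have "c k \<le> 1 / 2 ^ (K + Suc i)"
        unfolding c using time[of "Suc i"] True valid(2)[of "Suc i"] by (simp add: stage_length_def)
      then show ?thesis using pow by linarith
    next
      case False
      then have "Suc k \<le> m (Suc i) - 1" using k by simp
      then have "take k (w (Suc i)) = take k (w i)" "take (Suc k) (w (Suc i)) = take (Suc k) (w i)"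
        using w_take[of i] by (metis min.absorb1 take_take Suc_leD)+
      moreover have "p k = take k (w (Suc i))" "p (Suc k) = take (Suc k) (w (Suc i))" using k by (auto intro!: p_eq)
      ultimately have "c k \<le> 1 / 2 ^ (K + i)"
        unfolding c using time[of i] i k m_le[of i] valid(2)[of i] by simp
      then show ?thesis using pow by linarith
    qed
  qed
  \<comment> \<open>Using 2^(-i) in place of 2^(-(K+i)) only costs the constant factor 2^K.\<close>
  define b where "b i = real (stage_length (K + i)) / 2 ^ i" for i
  have "summable (\<lambda>i. 2 ^ K * (real (stage_length (i + K)) / 2 ^ (i + K)))"
    by (intro summable_mult summable_ignore_initial_segment summable_stage_time \<beta>)
  then have b: "summable b" by (simp add: b_def[abs_def] power_add add.commute)
  \<comment> \<open>The initial stretch consists of finitely many edges, so its cost is finite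
    whatever their speeds.\<close>
  define C where "C = (\<Sum>k<m 1. ennreal (c k))"
  have partial: "(\<Sum>k<m (Suc i). ennreal (c k)) \<le> C + (\<Sum>l<Suc i. ennreal (b l))" for i
  proof (induction i)
    case (Suc i)
    have "{..<m (Suc (Suc i))} = {..<m (Suc i)} \<union> {m (Suc i)..<m (Suc (Suc i))}"
      using m_less[of "Suc i"] by auto
    then have "(\<Sum>k<m (Suc (Suc i)). ennreal (c k)) =
        (\<Sum>k<m (Suc i). ennreal (c k)) + (\<Sum>k\<in>{m (Suc i)..<m (Suc (Suc i))}. ennreal (c k))"
      by (simp add: sum.union_disjoint ivl_disj_int)
    also have "(\<Sum>k\<in>{m (Suc i)..<m (Suc (Suc i))}. ennreal (c k)) \<le>
        (\<Sum>k\<in>{m (Suc i)..<m (Suc (Suc i))}. ennreal (1 / 2 ^ Suc i))"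
      using c_le[of "Suc i"] by (intro sum_mono ennreal_leI) auto
    also have "\<dots> = ennreal (real (m (Suc (Suc i)) - m (Suc i)) * (1 / 2 ^ Suc i))"
      by (simp only: sum_constant card_atLeastLessThan ennreal_of_nat_eq_real_of_nat)
        (rule ennreal_mult[symmetric], auto)
    also have "\<dots> \<le> ennreal (b (Suc i))"
    proof (rule ennreal_leI)
      have "real (m (Suc (Suc i)) - m (Suc i)) \<le> real (stage_length (K + Suc i))"
        using m_le[of "Suc i"] by linarith
      then have "real (m (Suc (Suc i)) - m (Suc i)) * (1 / 2 ^ Suc i) \<le> real (stage_length (K + Suc i)) * (1 / 2 ^ Suc i)"
        by (intro mult_right_mono) auto
      then show "real (m (Suc (Suc i)) - m (Suc i)) * (1 / 2 ^ Suc i) \<le> b (Suc i)" by (simp add: b_def)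
    qed
    finally have "(\<Sum>k<m (Suc (Suc i)). ennreal (c k)) \<le> (\<Sum>k<m (Suc i). ennreal (c k)) + ennreal (b (Suc i))"
      by (simp add: add_left_mono)
    also have "\<dots> \<le> (C + (\<Sum>l<Suc i. ennreal (b l))) + ennreal (b (Suc i))"
      by (intro add_right_mono Suc)
    also have "\<dots> = C + (\<Sum>l<Suc (Suc i). ennreal (b l))" by (simp add: add.assoc)
    finally show ?case .
  qed (simp add: C_def)
  have "(\<Sum>k. ennreal (c k)) \<le> C + (\<Sum>l. ennreal (b l))"
    unfolding suminf_eq_SUP[of "\<lambda>k. ennreal (c k)"]
  proof (rule SUP_least)
    fix n
    have "(\<Sum>k<n. ennreal (c k)) \<le> (\<Sum>k<m (Suc n). ennreal (c k))"
      using m_ge[of "Suc n"] by (intro sum_mono2) auto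
    also have "\<dots> \<le> C + (\<Sum>l<Suc n. ennreal (b l))" by (rule partial)
    also have "\<dots> \<le> C + (\<Sum>l. ennreal (b l))" by (intro add_left_mono sum_le_suminf summableI) auto
    finally show "(\<Sum>k<n. ennreal (c k)) \<le> C + (\<Sum>l. ennreal (b l))" .
  qed
  also have "\<dots> < \<infinity>"
  proof -
    have "C < \<infinity>" by (simp add: C_def)
    moreover have "(\<Sum>l. ennreal (b l)) = ennreal (suminf b)"
      by (rule suminf_ennreal2[OF _ b]) (simp add: b_def)
    ultimately show ?thesis by simp
  qed
  finally have "(\<Sum>k. ennreal (c k)) < \<infinity>" .
  then show ?thesis using geo unfolding c_def by blast
qed

lemma fast_case:
  assumes "\<beta> < 2"
  shows "AE \<omega> in P. \<exists>x. inf_geodesic_from troot x \<and>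
    (\<Sum>n. ennreal (driving_distance (Roads \<omega>) (x n) (x (Suc n)))) < \<infinity>"
  using AE_not_stuck AE_regular AE_space
  by eventually_elim (blast intro: exists_fast_path[OF assms])

end

theorem theorem2:
  fixes \<beta> :: real
    and \<mu> :: "tvert set measure"
    and P :: "'w measure"
    and Roads :: "'w \<Rightarrow> (tvert set \<times> real) set"
  assumes "\<beta> > 1"
    and "line_measure \<mu>"
    and "poisson_process P (road_intensity \<mu> \<beta>) Roads"
  shows "(\<beta> < 2 \<longrightarrow> (AE \<omega> in P. \<exists>x. inf_geodesic_from troot x \<and>
            (\<Sum>n. ennreal (driving_distance (Roads \<omega>) (x n) (x (Suc n)))) < \<infinity>)) \<and>
         (\<beta> > 2 \<longrightarrow> (AE \<omega> in P. \<forall>x. inf_geodesic_from troot x \<longrightarrow>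
            (\<Sum>n. ennreal (driving_distance (Roads \<omega>) (x n) (x (Suc n)))) = \<infinity>))"
proof -
  interpret tree_roads \<beta> \<mu> P Roads
    using assms by unfold_locales
  show ?thesis using slow_case fast_case by blast
qed

end
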